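(* Let $n\ge1$ and $M\sim\mathrm{GUE}_n$. Then $|\det M|$ has the same distribution as the product $\prod_{i=1}^nX_i$, where $X_1,\dots,X_n$ are independent random variables with $X_i\sim\chi_{2\lfloor i/2\rfloor+1}$.
   Context: $\mathrm{GUE}_n$ is the law of $\frac12(G+G^{\mathrm H})$, where $G$ is an $n\times n$ matrix whose entries have real and imaginary parts that are all independent standard normal, and $G^{\mathrm H}$ is the conjugate transpose. (So diagonal entries are standard normal, and the real and imaginary parts of entries above the diagonal are independent normals of mean $0$ and variance $\frac12$.) $\chi_k$ denotes the chi distribution with $k$ degrees of freedom, with density proportional to $x^{k-1}e^{-x^2/2}$ on $(0,\infty)$. *)

theory Defs
  imports "HOL-Probability.Probability"
begin

definition conj_transpose :: "complex^'n^'m \<Rightarrow> complex^'m^'n" where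
  "conj_transpose A = (\<chi> i j. cnj (A $ j $ i))"

(* The coordinate (i, j, False) is the real part of entry (i, j), and (i, j, True) its
   imaginary part. *)
definition complex_gaussian_matrix :: "(complex^'n^'n) measure" where
  "complex_gaussian_matrix =
     distr (\<Pi>\<^sub>M p\<in>(UNIV :: ('n \<times> 'n \<times> bool) set). density lborel std_normal_density) borel
       (\<lambda>g. \<chi> i j. Complex (g (i, j, False)) (g (i, j, True)))"

definition gue :: "(complex^'n^'n) measure" where
  "gue = distr complex_gaussian_matrix borel (\<lambda>G. (1/2) *\<^sub>R (G + conj_transpose G))"

definition chi_weight :: "nat \<Rightarrow> real \<Rightarrow> real" where
  "chi_weight k x = (if x > 0 then x ^ (k - 1) * exp (- x\<^sup>2 / 2) else 0)"

(* Intended for k \<ge> 1: the exponent k - 1 is truncated subtraction. *)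
definition chi_density :: "nat \<Rightarrow> real \<Rightarrow> real" where
  "chi_density k x = chi_weight k x / (\<integral>y. chi_weight k y \<partial>lborel)"

end

theory Submission
  imports Defs
begin

text \<open>
  Let \<open>D\<^sub>n\<close> be the leading principal minors of a GUE matrix. Expanding along a new row gives
  \<open>D\<^sub>n\<^sub>+\<^sub>1 = a D\<^sub>n - v\<^sup>* adj(M\<^sub>n) v\<close> with \<open>a\<close> standard normal and \<open>v\<close> complex Gaussian, and by
  unitary invariance of \<open>M\<^sub>n\<close> the pair \<open>(D\<^sub>n\<^sub>+\<^sub>1, D\<^sub>n)\<close> is distributed as
  \<open>(a D\<^sub>n - g D\<^sub>n\<^sub>-\<^sub>1, D\<^sub>n)\<close> with \<open>g = |v|\<^sup>2\<close>, a Gamma variable of shape \<open>n\<close>.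
  One shows by induction that \<open>(|D\<^sub>n|, |D\<^sub>n\<^sub>-\<^sub>1|)\<close> has the law of \<open>(X Y, V Y)\<close>, where
  \<open>X, V, Y\<close> are independent, \<open>X\<close> is \<open>\<chi>\<^sub>1\<close>, \<open>Y\<close> is the product of the remaining \<open>n - 1\<close>
  chi variables, and \<open>V\<close> is the first coordinate of a uniform unit vector in dimension
  \<open>2 k + 1\<close>, in modulus, with \<open>k = n div 2\<close>. In the induction step, with \<open>k' = (n + 1) div 2\<close>,
  the duplication formula \<open>g = \<chi>\<^sub>n \<chi>\<^sub>n\<^sub>+\<^sub>1\<close> (in law) turns \<open>g V\<close> into \<open>N B\<close> with \<open>N\<close> normal and
  \<open>B\<close> of law \<open>\<chi>\<close> with \<open>2 k'\<close> degrees of freedom; hence \<open>|a X - g V|\<close> is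
  \<open>X' sqrt (X\<^sup>2 + B\<^sup>2)\<close> with \<open>X'\<close> a new \<open>\<chi>\<^sub>1\<close>, and polar coordinates for \<open>(X, B)\<close> produce the next
  chi factor \<open>sqrt (X\<^sup>2 + B\<^sup>2)\<close> and, independently of it, the next \<open>V = X / sqrt (X\<^sup>2 + B\<^sup>2)\<close>.
\<close>

section \<open>Chi distributions\<close>

text \<open>The substitution rule for compact intervals is applied along an exhaustion of the
  half-line and passed to the limit by continuity of measure from below. The images of the intervals
  are matched with \<open>B\<close> by monotonicity and the intermediate value theorem.\<close>

lemma nn_integral_substitution_pos:
  fixes g g' :: "real \<Rightarrow> real" and f :: "real \<Rightarrow> ennreal"
  assumes f [measurable]: "f \<in> borel_measurable borel"
    and g [measurable]: "g \<in> borel_measurable borel" and g' [measurable]: "g' \<in> borel_measurable borel"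
    and deriv: "\<And>x. x > 0 \<Longrightarrow> (g has_real_derivative g' x) (at x)"
    and cont: "continuous_on {0<..} g'"
    and nonneg: "\<And>x. x > 0 \<Longrightarrow> g' x \<ge> 0"
    and img: "g ` {0<..} = B"
  shows "(\<integral>\<^sup>+x. f (g x) * ennreal (g' x) * indicator {0<..} x \<partial>lborel) =
         (\<integral>\<^sup>+y. f y * indicator B y \<partial>lborel)"
proof -
  \<comment> \<open>The shift by 2 gives \<open>a n < 1 < b n\<close>, so no interval is degenerate,
    even for \<open>n = 0\<close>.\<close>
  define a b where "a n = 1 / real (n + 2)" and "b n = real (n + 2)" for n :: nat
  have ab: "0 < a n" "a n \<le> b n" for n
    by (auto simp: a_def b_def field_simps)
  have mono: "g x \<le> g y" if "0 < x" "x \<le> y" for x y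
    using that by (intro DERIV_nonneg_imp_nondecreasing[of x y g]) (auto intro!: exI deriv nonneg)
  have dec: "a n \<le> a m" "b m \<le> b n" if "m \<le> n" for m n
    using that by (auto simp: a_def b_def field_simps)
  have incI: "incseq (\<lambda>n. {a n..b n})"
    using dec by (fastforce simp: incseq_def)
  have incG: "incseq (\<lambda>n. {g (a n)..g (b n)})"
  proof (rule incseq_SucI)
    fix n
    have "g (a (Suc n)) \<le> g (a n)" "g (b n) \<le> g (b (Suc n))"
      using ab dec[of n "Suc n"] by (auto intro!: mono intro: less_le_trans)
    then show "{g (a n)..g (b n)} \<subseteq> {g (a (Suc n))..g (b (Suc n))}" by auto
  qed
  have mem: "\<exists>n. x \<in> {a n..b n}" if "x > 0" for x
  proof -
    obtain n where n: "max x (1/x) < real n" using reals_Archimedean2 by blast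
    then have "x \<in> {a n..b n}" using that by (auto simp: a_def b_def field_simps)
    then show ?thesis ..
  qed
  have UI: "(\<Union>n. {a n..b n}) = {0<..}"
  proof (intro equalityI subsetI)
    fix x assume "x \<in> (\<Union>n. {a n..b n})" then show "x \<in> {0<..}"
      using ab(1) by (auto intro: less_le_trans)
  next
    fix x :: real assume "x \<in> {0<..}" then show "x \<in> (\<Union>n. {a n..b n})" using mem[of x] by auto
  qed
  have UG: "(\<Union>n. {g (a n)..g (b n)}) = B"
  proof (intro equalityI subsetI)
    fix y assume "y \<in> (\<Union>n. {g (a n)..g (b n)})"
    then obtain n where n: "g (a n) \<le> y" "y \<le> g (b n)" by auto
    have "\<exists>x\<ge>a n. x \<le> b n \<and> g x = y"
      using n ab(1)[of n] ab(2)[of n]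
      by (intro IVT) (auto intro!: DERIV_isCont[OF deriv])
    then show "y \<in> B" using ab(1)[of n] img by force
  next
    fix y assume "y \<in> B"
    then obtain x where x: "x > 0" "y = g x" using img by auto
    with mem obtain n where "x \<in> {a n..b n}" by blast
    then have "y \<in> {g (a n)..g (b n)}" using x ab(1)[of n] by (auto intro!: mono)
    then show "y \<in> (\<Union>n. {g (a n)..g (b n)})" by blast
  qed
  have "(\<integral>\<^sup>+x. f (g x) * ennreal (g' x) * indicator {0<..} x \<partial>lborel) =
      emeasure (density lborel (\<lambda>x. f (g x) * ennreal (g' x))) (\<Union>n. {a n..b n})"
    by (simp add: emeasure_density UI)
  also have "\<dots> = (SUP n. emeasure (density lborel (\<lambda>x. f (g x) * ennreal (g' x))) {a n..b n})"
    by (rule SUP_emeasure_incseq[symmetric]) (use incI in auto)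
  also have "\<dots> = (SUP n. emeasure (density lborel f) {g (a n)..g (b n)})"
  proof (rule SUP_cong)
    fix n
    have "a n < 1" "1 < b n" by (simp_all add: a_def b_def field_simps)
    then have "a n < b n" by simp
    moreover have "continuous_on {a n..b n} g'"
      using ab(1)[of n] by (intro continuous_on_subset[OF cont]) auto
    ultimately have "(\<integral>\<^sup>+x. f x * indicator {g (a n)..g (b n)} x \<partial>lborel) =
        (\<integral>\<^sup>+x. f (g x) * g' x * indicator {a n..b n} x \<partial>lborel)"
      using ab(1)[of n]
      by (intro nn_integral_substitution_aux deriv nonneg f) auto
    then show "emeasure (density lborel (\<lambda>x. f (g x) * ennreal (g' x))) {a n..b n} =
        emeasure (density lborel f) {g (a n)..g (b n)}"
      by (simp add: emeasure_density)
  qed simp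
  also have "\<dots> = emeasure (density lborel f) (\<Union>n. {g (a n)..g (b n)})"
    by (rule SUP_emeasure_incseq) (use incG in auto)
  also have "\<dots> = (\<integral>\<^sup>+y. f y * indicator B y \<partial>lborel)"
  proof -
    have "B \<in> sets lborel" unfolding UG[symmetric] by auto
    then show ?thesis by (simp add: emeasure_density UG)
  qed
  finally show ?thesis .
qed

section \<open>Normalisation of the chi and cosine laws\<close>

definition chi_measure :: "nat \<Rightarrow> real measure" where
  "chi_measure k = density lborel (\<lambda>x. ennreal (chi_density k x))"

definition chi_mass :: "nat \<Rightarrow> real" where
  "chi_mass k = (\<integral>y. chi_weight k y \<partial>lborel)"

text \<open>For \<open>j >= 1\<close> this is (1 - v^2) to the power j/2 - 1, the unnormalised
  density of the modulus of the first coordinate of a uniform unit vector in dimension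
  \<open>j + 1\<close>. The quotient form avoids truncated subtraction in the exponent.\<close>

definition cos_weight :: "nat \<Rightarrow> real \<Rightarrow> real" where
  "cos_weight j v = (if 0 < v \<and> v < 1 then sqrt (1 - v\<^sup>2) ^ j / (1 - v\<^sup>2) else 0)"

text \<open>The constant is the one that the polar change of variables in \<open>chi_polar\<close>
  produces; \<open>prob_space_cos_measure\<close> shows that it normalises the weight for
  \<open>j >= 1\<close>.\<close>

definition cos_measure :: "nat \<Rightarrow> real measure" where
  "cos_measure j = density lborel
     (\<lambda>v. ennreal (chi_mass (Suc j) / (chi_mass 1 * chi_mass j) * cos_weight j v))"

lemma chi_weight_measurable [measurable]: "chi_weight k \<in> borel_measurable borel"
  unfolding chi_weight_def by measurable

lemma cos_weight_measurable [measurable]: "cos_weight k \<in> borel_measurable borel"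
  unfolding cos_weight_def by measurable

lemma chi_density_measurable [measurable]: "chi_density k \<in> borel_measurable borel"
  unfolding chi_density_def by measurable

lemma chi_weight_nonneg [simp]: "chi_weight k x \<ge> 0"
  by (simp add: chi_weight_def)

lemma cos_weight_nonneg [simp]: "cos_weight k x \<ge> 0"
  by (auto simp: cos_weight_def power_le_one)

lemma sets_chi_measure [simp, measurable_cong]: "sets (chi_measure k) = sets borel"
  by (simp add: chi_measure_def)

lemma space_chi_measure [simp]: "space (chi_measure k) = UNIV"
  by (simp add: chi_measure_def)

lemma sets_cos_measure [simp, measurable_cong]: "sets (cos_measure k) = sets borel"
  by (simp add: cos_measure_def)

text \<open>Up to the factor \<open>sqrt (2 * pi)\<close> the weight is dominated by the integrand
  of an absolute moment of the standard normal law.\<close>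

lemma chi_weight_integrable: "integrable lborel (chi_weight k)"
proof (rule Bochner_Integration.integrable_bound)
  show "integrable lborel (\<lambda>x. sqrt (2 * pi) * (std_normal_density x * \<bar>x\<bar> ^ (k - 1)))"
    by (intro integrable_mult_right integrable_std_normal_moment_abs)
  show "AE x in lborel. norm (chi_weight k x) \<le> norm (sqrt (2 * pi) * (std_normal_density x * \<bar>x\<bar> ^ (k - 1)))"
    by (auto simp: chi_weight_def std_normal_density_def abs_mult)
qed simp

lemma nn_integral_chi_weight: "(\<integral>\<^sup>+x. chi_weight k x \<partial>lborel) = ennreal (chi_mass k)"
  unfolding chi_mass_def by (intro nn_integral_eq_integral chi_weight_integrable) simp

lemma chi_mass_pos: "chi_mass k > 0"
proof -
  have "chi_mass k \<ge> 0"
    unfolding chi_mass_def by (intro integral_nonneg_AE) simp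
  moreover have "chi_mass k \<noteq> 0"
  proof
    assume "chi_mass k = 0"
    then have "(\<integral>\<^sup>+x. chi_weight k x \<partial>lborel) = 0"
      by (simp add: nn_integral_chi_weight)
    then have "AE x in lborel. chi_weight k x = 0"
      by (simp add: nn_integral_0_iff_AE)
    then have "AE x in lborel. x \<notin> {0<..<1::real}"
      by eventually_elim (auto simp: chi_weight_def split: if_splits)
    then have "emeasure lborel {0<..<1::real} = 0"
      by (subst (asm) AE_iff_measurable[of "{0<..<1::real}"]) auto
    then show False by simp
  qed
  ultimately show ?thesis by simp
qed

lemma chi_density_eq: "chi_density k x = chi_weight k x / chi_mass k"
  by (simp add: chi_density_def chi_mass_def)

lemma nn_integral_chi_measure:
  assumes [measurable]: "F \<in> borel_measurable borel"
  shows "(\<integral>\<^sup>+x. F x \<partial>chi_measure k) =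
    ennreal (1 / chi_mass k) * (\<integral>\<^sup>+x. F x * ennreal (chi_weight k x) \<partial>lborel)"
proof -
  have "(\<integral>\<^sup>+x. F x \<partial>chi_measure k) = (\<integral>\<^sup>+x. ennreal (1 / chi_mass k) * (F x * ennreal (chi_weight k x)) \<partial>lborel)"
    unfolding chi_measure_def
    by (subst nn_integral_density)
       (auto intro!: nn_integral_cong simp: chi_density_eq chi_mass_pos less_imp_le mult.left_commute
          mult.commute[of "F _"] simp flip: ennreal_mult' mult.assoc)
  also have "\<dots> = ennreal (1 / chi_mass k) * (\<integral>\<^sup>+x. F x * ennreal (chi_weight k x) \<partial>lborel)"
    by (rule nn_integral_cmult) simp
  finally show ?thesis .
qed

lemma nn_integral_cos_measure:
  assumes [measurable]: "F \<in> borel_measurable borel"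
  shows "(\<integral>\<^sup>+x. F x \<partial>cos_measure k) =
    ennreal (chi_mass (Suc k) / (chi_mass 1 * chi_mass k)) * (\<integral>\<^sup>+x. F x * ennreal (cos_weight k x) \<partial>lborel)"
proof -
  define c where "c = chi_mass (Suc k) / (chi_mass 1 * chi_mass k)"
  have "c \<ge> 0"
    using chi_mass_pos by (simp add: c_def less_imp_le)
  then have "(\<integral>\<^sup>+x. F x \<partial>cos_measure k) = (\<integral>\<^sup>+x. ennreal c * (F x * ennreal (cos_weight k x)) \<partial>lborel)"
    unfolding cos_measure_def c_def[symmetric]
    by (subst nn_integral_density)
       (auto intro!: nn_integral_cong simp: ennreal_mult mult_ac)
  also have "\<dots> = ennreal c * (\<integral>\<^sup>+x. F x * ennreal (cos_weight k x) \<partial>lborel)"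
    by (rule nn_integral_cmult) simp
  finally show ?thesis by (simp only: c_def)
qed

lemma prob_space_chi_measure: "prob_space (chi_measure k)"
proof (rule prob_spaceI)
  have "emeasure (chi_measure k) (space (chi_measure k)) = (\<integral>\<^sup>+x. 1 \<partial>chi_measure k)"
    by (simp only: nn_integral_const) simp
  also have "\<dots> = 1"
    by (subst nn_integral_chi_measure)
      (use chi_mass_pos[of k] in \<open>auto simp: nn_integral_chi_weight simp flip: ennreal_mult\<close>)
  finally show "emeasure (chi_measure k) (space (chi_measure k)) = 1" .
qed

section \<open>Polar coordinates for independent chi variables\<close>

text \<open>For fixed \<open>a\<close> the variable b is replaced by z = sqrt(a^2 + b^2), with dz =
  (b / z) db. The two exponentials merge into one depending on z alone, and b^(j-1) db becomes z
  b^(j-2) dz with b^2 = z^2 - a^2.\<close>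

lemma chi_polar_inner:
  assumes [measurable]: "case_prod F \<in> borel_measurable (borel \<Otimes>\<^sub>M borel)" and a: "a > 0" and j: "j \<ge> 1"
  shows "(\<integral>\<^sup>+b. F (sqrt (a\<^sup>2 + b\<^sup>2)) a * ennreal (chi_weight j b) \<partial>lborel) * ennreal (chi_weight 1 a) =
    (\<integral>\<^sup>+z. F z a * ennreal (z * exp (- z\<^sup>2 / 2) * (sqrt (z\<^sup>2 - a\<^sup>2) ^ j / (z\<^sup>2 - a\<^sup>2))) * indicator {a<..} z \<partial>lborel)"
proof -
  define f where "f z = F z a * ennreal (z * exp (- z\<^sup>2 / 2) * (sqrt (z\<^sup>2 - a\<^sup>2) ^ j / (z\<^sup>2 - a\<^sup>2)))" for z
  have [measurable]: "f \<in> borel_measurable borel"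
    unfolding f_def by measurable
  let ?g = "\<lambda>b. sqrt (a\<^sup>2 + b\<^sup>2)"
  have pos: "a\<^sup>2 + b\<^sup>2 > 0" for b
    using a by (simp add: add_pos_nonneg)
  have img: "?g ` {0<..} = {a<..}"
  proof (intro equalityI subsetI)
    fix z assume "z \<in> ?g ` {0<..}"
    then show "z \<in> {a<..}" using a by (auto intro: real_less_rsqrt)
  next
    fix z assume z: "z \<in> {a<..}"
    then have "z\<^sup>2 > a\<^sup>2" using a by (auto intro: power_strict_mono)
    then show "z \<in> ?g ` {0<..}"
      using z a by (intro image_eqI[of _ _ "sqrt (z\<^sup>2 - a\<^sup>2)"]) auto
  qed
  have "(\<integral>\<^sup>+z. f z * indicator {a<..} z \<partial>lborel) =
    (\<integral>\<^sup>+b. f (?g b) * ennreal (b / ?g b) * indicator {0<..} b \<partial>lborel)"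
  proof (rule nn_integral_substitution_pos[symmetric, OF _ _ _ _ _ _ img])
    show "(?g has_real_derivative b / ?g b) (at b)" if "b > 0" for b
      using pos[of b] by (auto intro!: derivative_eq_intros simp: field_simps)
    show "continuous_on {0<..} (\<lambda>b. b / ?g b)"
      using pos by (intro continuous_intros) (auto simp: less_imp_neq[symmetric] simp del: real_sqrt_eq_zero_cancel_iff)
  qed auto
  also have "\<dots> = (\<integral>\<^sup>+b. (F (?g b) a * ennreal (chi_weight j b)) * ennreal (chi_weight 1 a) \<partial>lborel)"
  proof (rule nn_integral_cong)
    fix b :: real
    show "f (?g b) * ennreal (b / ?g b) * indicator {0<..} b =
      (F (?g b) a * ennreal (chi_weight j b)) * ennreal (chi_weight 1 a)"
    proof (cases "b > 0")
      case True
      \<comment> \<open>The bound \<open>j >= 1\<close> enters here: at \<open>j = 0\<close> the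
        truncated exponent \<open>j - 1\<close> would give 1 instead of 1 / b.\<close>
      have "b ^ j / b\<^sup>2 * b = b ^ (j - 1)"
        using True j by (cases j) (auto simp: power2_eq_square)
      moreover have "?g b * (exp (- (a\<^sup>2 + b\<^sup>2) / 2) * (b ^ j / b\<^sup>2)) * (b / ?g b) =
        (b ^ j / b\<^sup>2 * b) * exp (- b\<^sup>2 / 2) * exp (- a\<^sup>2 / 2)"
        using pos[of b] by (simp add: exp_add[symmetric] add_divide_distrib diff_divide_distrib
          del: power_divide add: add.commute mult_ac)
      ultimately have eq: "?g b * exp (- (a\<^sup>2 + b\<^sup>2) / 2) * (b ^ j / b\<^sup>2) * (b / ?g b) =
        chi_weight j b * chi_weight 1 a"
        using True a by (simp add: chi_weight_def mult_ac)
      have "f (?g b) * ennreal (b / ?g b) = F (?g b) a * (ennreal (?g b * exp (- (a\<^sup>2 + b\<^sup>2) / 2) * (b ^ j / b\<^sup>2)) * ennreal (b / ?g b))"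
        using True pos[of b] by (simp add: f_def mult.assoc)
      also have "ennreal (?g b * exp (- (a\<^sup>2 + b\<^sup>2) / 2) * (b ^ j / b\<^sup>2)) * ennreal (b / ?g b) = ennreal (chi_weight j b * chi_weight 1 a)"
        unfolding eq[symmetric] using True by (intro ennreal_mult[symmetric]) auto
      finally show ?thesis using True by (simp add: ennreal_mult mult_ac)
    qed (simp add: chi_weight_def)
  qed
  also have "\<dots> = (\<integral>\<^sup>+b. F (?g b) a * ennreal (chi_weight j b) \<partial>lborel) * ennreal (chi_weight 1 a)"
    by (rule nn_integral_multc) simp
  finally show ?thesis by (simp add: f_def)
qed

text \<open>Scaling a = v z separates the variables: the factors of \<open>z\<close> collect to z^j,
  the power in the chi weight with \<open>j + 1\<close> degrees of freedom, and the rest of the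
  weight depends on v alone.\<close>

lemma chi_polar_outer:
  assumes [measurable]: "case_prod F \<in> borel_measurable (borel \<Otimes>\<^sub>M borel)" and z: "z > 0" and j: "j \<ge> 1"
  shows "(\<integral>\<^sup>+a. F z a * ennreal (z * exp (- z\<^sup>2 / 2) * (sqrt (z\<^sup>2 - a\<^sup>2) ^ j / (z\<^sup>2 - a\<^sup>2))) * indicator {0<..<z} a \<partial>lborel) =
    (\<integral>\<^sup>+v. F z (v * z) * ennreal (cos_weight j v) \<partial>lborel) * ennreal (chi_weight (Suc j) z)"
proof -
  define f where "f a = F z a * ennreal (z * exp (- z\<^sup>2 / 2) * (sqrt (z\<^sup>2 - a\<^sup>2) ^ j / (z\<^sup>2 - a\<^sup>2))) * indicator {0<..<z} a" for a
  have [measurable]: "f \<in> borel_measurable borel"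
    unfolding f_def by measurable
  have "(\<integral>\<^sup>+a. f a \<partial>lborel) = ennreal z * (\<integral>\<^sup>+v. f (z * v) \<partial>lborel)"
    using nn_integral_real_affine[of f z 0] z by simp
  also have "\<dots> = (\<integral>\<^sup>+v. ennreal z * f (z * v) \<partial>lborel)"
    by (rule nn_integral_cmult[symmetric]) simp
  also have "\<dots> = (\<integral>\<^sup>+v. F z (v * z) * ennreal (cos_weight j v) * ennreal (chi_weight (Suc j) z) \<partial>lborel)"
  proof (rule nn_integral_cong)
    fix v :: real
    show "ennreal z * f (z * v) = F z (v * z) * ennreal (cos_weight j v) * ennreal (chi_weight (Suc j) z)"
    proof (cases "0 < v \<and> v < 1")
      case True
      then have v2: "1 - v\<^sup>2 > 0" by (simp add: power_less_one_iff)
      have *: "z\<^sup>2 - (z * v)\<^sup>2 = z\<^sup>2 * (1 - v\<^sup>2)" by (simp add: power_mult_distrib algebra_simps)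
      have "sqrt (z\<^sup>2 - (z * v)\<^sup>2) = z * sqrt (1 - v\<^sup>2)" unfolding * using z by (simp add: real_sqrt_mult)
      then have eq: "z * (z * exp (- z\<^sup>2 / 2) * (sqrt (z\<^sup>2 - (z * v)\<^sup>2) ^ j / (z\<^sup>2 - (z * v)\<^sup>2))) =
        cos_weight j v * chi_weight (Suc j) z"
        using True z v2 unfolding *
        by (simp add: cos_weight_def chi_weight_def power_mult_distrib power2_eq_square)
      have nn: "z * exp (- z\<^sup>2 / 2) * (sqrt (z\<^sup>2 - (z * v)\<^sup>2) ^ j / (z\<^sup>2 - (z * v)\<^sup>2)) \<ge> 0"
        unfolding * using z v2 by simp
      have "z * v \<in> {0<..<z}" using z True by auto
      then have "ennreal z * f (z * v) = F z (v * z) * (ennreal z * ennreal (z * exp (- z\<^sup>2 / 2) * (sqrt (z\<^sup>2 - (z * v)\<^sup>2) ^ j / (z\<^sup>2 - (z * v)\<^sup>2))))"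
        by (simp add: f_def mult_ac)
      also have "\<dots> = F z (v * z) * ennreal (cos_weight j v * chi_weight (Suc j) z)"
        unfolding eq[symmetric] using z nn by (subst ennreal_mult) auto
      finally show ?thesis by (simp add: ennreal_mult mult_ac)
    next
      case False
      then have "z * v \<notin> {0<..<z}" using z by (auto simp: zero_less_mult_iff)
      then show ?thesis using False by (auto simp: f_def cos_weight_def)
    qed
  qed
  also have "\<dots> = (\<integral>\<^sup>+v. F z (v * z) * ennreal (cos_weight j v) \<partial>lborel) * ennreal (chi_weight (Suc j) z)"
    by (rule nn_integral_multc) simp
  finally show ?thesis by (simp add: f_def)
qed

text \<open>Tonelli on the region 0 < a < z links the two substitutions: first z replaces b with a
  fixed, then v replaces a with z fixed.\<close>

lemma chi_polar_weight:
  assumes F [measurable]: "case_prod F \<in> borel_measurable (borel \<Otimes>\<^sub>M borel)" and j: "j \<ge> 1"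
  shows "(\<integral>\<^sup>+a. (\<integral>\<^sup>+b. F (sqrt (a\<^sup>2 + b\<^sup>2)) a * ennreal (chi_weight j b) \<partial>lborel) * ennreal (chi_weight 1 a) \<partial>lborel) =
    (\<integral>\<^sup>+z. (\<integral>\<^sup>+v. F z (v * z) * ennreal (cos_weight j v) \<partial>lborel) * ennreal (chi_weight (Suc j) z) \<partial>lborel)"
proof -
  define h where "h z a = F z a * ennreal (z * exp (- z\<^sup>2 / 2) * (sqrt (z\<^sup>2 - a\<^sup>2) ^ j / (z\<^sup>2 - a\<^sup>2)))" for z a
  have [measurable]: "case_prod h \<in> borel_measurable (borel \<Otimes>\<^sub>M borel)"
    unfolding h_def by measurable
  have "(\<integral>\<^sup>+a. (\<integral>\<^sup>+b. F (sqrt (a\<^sup>2 + b\<^sup>2)) a * ennreal (chi_weight j b) \<partial>lborel) * ennreal (chi_weight 1 a) \<partial>lborel) =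
    (\<integral>\<^sup>+a. (\<integral>\<^sup>+z. h z a * (if 0 < a \<and> a < z then 1 else 0) \<partial>lborel) \<partial>lborel)"
  proof (rule nn_integral_cong)
    fix a :: real
    show "(\<integral>\<^sup>+b. F (sqrt (a\<^sup>2 + b\<^sup>2)) a * ennreal (chi_weight j b) \<partial>lborel) * ennreal (chi_weight 1 a) =
      (\<integral>\<^sup>+z. h z a * (if 0 < a \<and> a < z then 1 else 0) \<partial>lborel)"
    proof (cases "a > 0")
      case True
      show ?thesis
        unfolding chi_polar_inner[OF F True j]
        by (intro nn_integral_cong) (use True in \<open>auto simp: h_def\<close>)
    qed (simp add: chi_weight_def)
  qed
  also have "\<dots> = (\<integral>\<^sup>+z. (\<integral>\<^sup>+a. h z a * (if 0 < a \<and> a < z then 1 else 0) \<partial>lborel) \<partial>lborel)"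
    by (rule lborel_pair.Fubini') measurable
  also have "\<dots> = (\<integral>\<^sup>+z. (\<integral>\<^sup>+v. F z (v * z) * ennreal (cos_weight j v) \<partial>lborel) * ennreal (chi_weight (Suc j) z) \<partial>lborel)"
  proof (rule nn_integral_cong)
    fix z :: real
    show "(\<integral>\<^sup>+a. h z a * (if 0 < a \<and> a < z then 1 else 0) \<partial>lborel) =
      (\<integral>\<^sup>+v. F z (v * z) * ennreal (cos_weight j v) \<partial>lborel) * ennreal (chi_weight (Suc j) z)"
    proof (cases "z > 0")
      case True
      show ?thesis
        unfolding chi_polar_outer[OF F True j, symmetric]
        by (intro nn_integral_cong) (auto simp: h_def)
    qed (auto simp: chi_weight_def intro!: nn_integral_zero' AE_I2)
  qed
  finally show ?thesis .
qed

lemma sigma_finite_chi_measure: "sigma_finite_measure (chi_measure k)"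
  by (intro prob_space_imp_sigma_finite prob_space_chi_measure)

text \<open>Polar coordinates for independent chi variables with 1 and \<open>j\<close> degrees of
  freedom: the radius has \<open>j + 1\<close> degrees of freedom and is independent of the cosine
  v. Keeping both outputs in \<open>F\<close> makes the next three lemmas specialisations of this
  one.\<close>

lemma chi_polar:
  assumes F [measurable]: "case_prod F \<in> borel_measurable (borel \<Otimes>\<^sub>M borel)" and j: "j \<ge> 1"
  shows "(\<integral>\<^sup>+a. (\<integral>\<^sup>+b. F (sqrt (a\<^sup>2 + b\<^sup>2)) a \<partial>chi_measure j) \<partial>chi_measure 1) =
    (\<integral>\<^sup>+z. (\<integral>\<^sup>+v. F z (v * z) \<partial>cos_measure j) \<partial>chi_measure (Suc j))"
proof -
  let ?c = chi_mass
  have pos: "?c i > 0" "?c i \<ge> 0" for i using chi_mass_pos[of i] by auto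
  have "(\<integral>\<^sup>+a. (\<integral>\<^sup>+b. F (sqrt (a\<^sup>2 + b\<^sup>2)) a \<partial>chi_measure j) \<partial>chi_measure 1) =
    ennreal (1 / ?c 1) * (\<integral>\<^sup>+a. ennreal (1 / ?c j) * ((\<integral>\<^sup>+b. F (sqrt (a\<^sup>2 + b\<^sup>2)) a * ennreal (chi_weight j b) \<partial>lborel) * ennreal (chi_weight 1 a)) \<partial>lborel)"
    by (simp add: nn_integral_chi_measure mult.assoc)
  also have "\<dots> = ennreal (1 / ?c 1) * (ennreal (1 / ?c j) * (\<integral>\<^sup>+z. (\<integral>\<^sup>+v. F z (v * z) * ennreal (cos_weight j v) \<partial>lborel) * ennreal (chi_weight (Suc j) z) \<partial>lborel))"
    by (subst nn_integral_cmult) (auto simp: chi_polar_weight[OF F j] simp del: One_nat_def)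
  \<comment> \<open>Inserting and cancelling \<open>?c (Suc j)\<close> splits the constant between
    the radial law and the cosine law.\<close>
  also have "\<dots> = ennreal (1 / ?c (Suc j)) * (ennreal (?c (Suc j) / (?c 1 * ?c j)) * (\<integral>\<^sup>+z. (\<integral>\<^sup>+v. F z (v * z) * ennreal (cos_weight j v) \<partial>lborel) * ennreal (chi_weight (Suc j) z) \<partial>lborel))"
    unfolding mult.assoc[symmetric]
    using pos[of 1] pos[of j] pos[of "Suc j"]
    by (intro arg_cong2[where f="(*)", OF _ refl]) (simp add: field_simps flip: ennreal_mult')
  also have "\<dots> = (\<integral>\<^sup>+z. (\<integral>\<^sup>+v. F z (v * z) \<partial>cos_measure j) \<partial>chi_measure (Suc j))"
    by (simp add: nn_integral_chi_measure nn_integral_cos_measure mult.assoc nn_integral_cmult mult.left_commute)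
  finally show ?thesis .
qed

text \<open>With constant \<open>F\<close> in \<open>chi_polar\<close> both sides are total masses,
  and the chi measures contribute 1. No Beta integral is evaluated.\<close>

lemma prob_space_cos_measure:
  assumes "j \<ge> 1"
  shows "prob_space (cos_measure j)"
proof -
  interpret X: prob_space "chi_measure 1" by (rule prob_space_chi_measure)
  interpret Y: prob_space "chi_measure j" by (rule prob_space_chi_measure)
  interpret Z: prob_space "chi_measure (Suc j)" by (rule prob_space_chi_measure)
  have "1 = emeasure (cos_measure j) (space (cos_measure j))"
    using chi_polar[of "\<lambda>_ _. 1" j] assms X.emeasure_space_1 Y.emeasure_space_1 Z.emeasure_space_1
    by simp
  then show ?thesis by (intro prob_spaceI) simp
qed

lemma cos_measure_times_chi:
  assumes [measurable]: "F \<in> borel_measurable borel" and j: "j \<ge> 1"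
  shows "(\<integral>\<^sup>+z. (\<integral>\<^sup>+v. F (v * z) \<partial>cos_measure j) \<partial>chi_measure (Suc j)) = (\<integral>\<^sup>+a. F a \<partial>chi_measure 1)"
proof -
  interpret Y: prob_space "chi_measure j" by (rule prob_space_chi_measure)
  show ?thesis
    using chi_polar[of "\<lambda>_. F" j, symmetric] j Y.emeasure_space_1 by simp
qed

lemma chi_add_squares:
  assumes [measurable]: "F \<in> borel_measurable borel" and j: "j \<ge> 1"
  shows "(\<integral>\<^sup>+a. (\<integral>\<^sup>+b. F (sqrt (a\<^sup>2 + b\<^sup>2)) \<partial>chi_measure j) \<partial>chi_measure 1) = (\<integral>\<^sup>+z. F z \<partial>chi_measure (Suc j))"
proof -
  interpret Y: prob_space "cos_measure j" by (rule prob_space_cos_measure[OF j])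
  show ?thesis
    using chi_polar[of "\<lambda>z _. F z" j] j Y.emeasure_space_1 by simp
qed

section \<open>The duplication formula for chi variables\<close>

text \<open>The map x - p / x increases from the positive half-line onto the real line and has
  derivative 1 + p / x^2, so the integral is the Gaussian one, whatever \<open>p\<close> is.\<close>

lemma nn_integral_exp_cauchy_schloemilch:
  assumes p: "p > 0"
  shows "(\<integral>\<^sup>+x. ennreal (exp (- (x - p / x)\<^sup>2 / 2) * (1 + p / x\<^sup>2)) * indicator {0<..} x \<partial>lborel) = ennreal (sqrt (2 * pi))"
proof -
  let ?g = "\<lambda>x::real. x - p / x"
  have img: "?g ` {0<..} = UNIV"
  proof (intro equalityI subsetI)
    fix t :: real
    \<comment> \<open>The positive root of x^2 - t x - p = 0.\<close>
    let ?x = "(t + sqrt (t\<^sup>2 + 4 * p)) / 2"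
    have "\<bar>t\<bar> < sqrt (t\<^sup>2 + 4 * p)" using p by (intro real_less_rsqrt) auto
    then have x: "?x > 0" by auto
    have "?x\<^sup>2 - t * ?x = p"
      using p by (simp add: power2_eq_square field_simps)
    then have "t = ?x - p / ?x" using x by (simp add: field_simps power2_eq_square)
    then show "t \<in> ?g ` {0<..}" using x by (intro image_eqI[of _ _ ?x]) auto
  qed simp
  have "(\<integral>\<^sup>+x. ennreal (exp (- (?g x)\<^sup>2 / 2)) * ennreal (1 + p / x\<^sup>2) * indicator {0<..} x \<partial>lborel) =
    (\<integral>\<^sup>+t. ennreal (exp (- t\<^sup>2 / 2)) * indicator UNIV t \<partial>lborel)"
  proof (rule nn_integral_substitution_pos[OF _ _ _ _ _ _ img])
    show "(?g has_real_derivative 1 + p / x\<^sup>2) (at x)" if "x > 0" for x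
      using that by (auto intro!: derivative_eq_intros simp: power2_eq_square)
    show "continuous_on {0<..} (\<lambda>x. 1 + p / x\<^sup>2)"
      by (intro continuous_intros) auto
  qed (use p in auto)
  also have "\<dots> = (\<integral>\<^sup>+t. ennreal (sqrt (2 * pi)) * ennreal (std_normal_density t) \<partial>lborel)"
    by (intro nn_integral_cong) (simp add: std_normal_density_def flip: ennreal_mult')
  also have "\<dots> = ennreal (sqrt (2 * pi)) * (\<integral>\<^sup>+t. ennreal (std_normal_density t) \<partial>lborel)"
    by (rule nn_integral_cmult) simp
  also have "(\<integral>\<^sup>+t. ennreal (std_normal_density t) \<partial>lborel) = 1"
    using prob_space.emeasure_space_1[OF prob_space_normal_density[of 1 0]]
    by (simp add: emeasure_density)
  finally show ?thesis
    by (simp add: ennreal_mult' mult.assoc)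
qed

text \<open>Substituting p = x y for fixed \<open>x\<close> brings in the Jacobian 1 / x. Completing
  the square, x^2 / 2 + (p / x)^2 / 2 = p + (x - p / x)^2 / 2, isolates the exponent that the
  Cauchy-Schloemilch substitution handles.\<close>

lemma chi_product_inner:
  assumes [measurable]: "F \<in> borel_measurable borel" and x: "x > 0"
  shows "(\<integral>\<^sup>+y. F (x * y) * ennreal (chi_weight l y) \<partial>lborel) * ennreal (chi_weight k x) =
    (\<integral>\<^sup>+p. F p * ennreal (x ^ (k - 1) * (p / x) ^ (l - 1) / x * exp (- p) * exp (- (x - p / x)\<^sup>2 / 2)) * indicator {0<..} p \<partial>lborel)"
proof -
  define f where "f y = F (x * y) * ennreal (chi_weight l y)" for y
  have [measurable]: "f \<in> borel_measurable borel" unfolding f_def by measurable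
  have "(\<integral>\<^sup>+y. f y \<partial>lborel) = ennreal (1 / x) * (\<integral>\<^sup>+p. f (p / x) \<partial>lborel)"
    using nn_integral_real_affine[of f "1 / x" 0] x by simp
  then have "(\<integral>\<^sup>+y. f y \<partial>lborel) * ennreal (chi_weight k x) = (\<integral>\<^sup>+p. f (p / x) * (ennreal (1 / x) * ennreal (chi_weight k x)) \<partial>lborel)"
    by (subst nn_integral_multc) (simp_all add: mult_ac)
  also have "\<dots> = (\<integral>\<^sup>+p. F p * ennreal (x ^ (k - 1) * (p / x) ^ (l - 1) / x * exp (- p) * exp (- (x - p / x)\<^sup>2 / 2)) * indicator {0<..} p \<partial>lborel)"
  proof (rule nn_integral_cong)
    fix p :: real
    show "f (p / x) * (ennreal (1 / x) * ennreal (chi_weight k x)) =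
      F p * ennreal (x ^ (k - 1) * (p / x) ^ (l - 1) / x * exp (- p) * exp (- (x - p / x)\<^sup>2 / 2)) * indicator {0<..} p"
    proof (cases "p > 0")
      case True
      have "exp (- p) * exp (- (x - p / x)\<^sup>2 / 2) = exp (- (p / x)\<^sup>2 / 2) * exp (- x\<^sup>2 / 2)"
        using x by (simp add: exp_add[symmetric] power2_eq_square field_simps)
      then have eq: "x ^ (k - 1) * (p / x) ^ (l - 1) / x * exp (- p) * exp (- (x - p / x)\<^sup>2 / 2) =
        chi_weight l (p / x) * (1 / x * chi_weight k x)"
        using True x by (simp add: chi_weight_def mult_ac)
      show ?thesis unfolding eq using True x
        by (simp add: f_def mult.assoc ennreal_mult' flip: ennreal_mult')
    qed (use x in \<open>simp add: f_def chi_weight_def zero_less_divide_iff\<close>)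
  qed
  finally show ?thesis by (simp add: f_def)
qed

lemma chi_product_weight:
  assumes F [measurable]: "F \<in> borel_measurable borel"
  shows "(\<integral>\<^sup>+x. (\<integral>\<^sup>+y. F (x * y) * ennreal (chi_weight l y) \<partial>lborel) * ennreal (chi_weight k x) \<partial>lborel) =
    (\<integral>\<^sup>+p. (\<integral>\<^sup>+x. F p * ennreal (exp (- p)) * ennreal (x ^ (k - 1) * (p / x) ^ (l - 1) / x * exp (- (x - p / x)\<^sup>2 / 2)) * indicator {0<..} x \<partial>lborel) * indicator {0<..} p \<partial>lborel)"
proof -
  define h where "h x p = F p * ennreal (exp (- p)) * ennreal (x ^ (k - 1) * (p / x) ^ (l - 1) / x * exp (- (x - p / x)\<^sup>2 / 2)) *
    indicator {0<..} x * indicator {0<..} p" for x p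
  have [measurable]: "case_prod h \<in> borel_measurable (borel \<Otimes>\<^sub>M borel)"
    unfolding h_def by measurable
  have "(\<integral>\<^sup>+x. (\<integral>\<^sup>+y. F (x * y) * ennreal (chi_weight l y) \<partial>lborel) * ennreal (chi_weight k x) \<partial>lborel) =
    (\<integral>\<^sup>+x. (\<integral>\<^sup>+p. h x p \<partial>lborel) \<partial>lborel)"
  proof (rule nn_integral_cong)
    fix x :: real
    show "(\<integral>\<^sup>+y. F (x * y) * ennreal (chi_weight l y) \<partial>lborel) * ennreal (chi_weight k x) = (\<integral>\<^sup>+p. h x p \<partial>lborel)"
    proof (cases "x > 0")
      case True
      show ?thesis
        unfolding chi_product_inner[OF F True]
        by (intro nn_integral_cong)
          (use True in \<open>auto simp: h_def mult_ac indicator_def simp flip: ennreal_mult'\<close>)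
    qed (simp add: chi_weight_def h_def)
  qed
  also have "\<dots> = (\<integral>\<^sup>+p. (\<integral>\<^sup>+x. h x p \<partial>lborel) \<partial>lborel)"
    by (rule lborel_pair.Fubini') measurable
  also have "\<dots> = (\<integral>\<^sup>+p. (\<integral>\<^sup>+x. F p * ennreal (exp (- p)) * ennreal (x ^ (k - 1) * (p / x) ^ (l - 1) / x * exp (- (x - p / x)\<^sup>2 / 2)) * indicator {0<..} x \<partial>lborel) * indicator {0<..} p \<partial>lborel)"
    unfolding h_def by (intro nn_integral_cong nn_integral_multc) measurable
  finally show ?thesis .
qed

lemma chi_product_commute:
  assumes [measurable]: "F \<in> borel_measurable borel"
  shows "(\<integral>\<^sup>+x. (\<integral>\<^sup>+y. F (x * y) \<partial>chi_measure l) \<partial>chi_measure k) =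
    (\<integral>\<^sup>+x. (\<integral>\<^sup>+y. F (x * y) \<partial>chi_measure k) \<partial>chi_measure l)"
proof -
  interpret pair_sigma_finite "chi_measure l" "chi_measure k"
    by (intro pair_sigma_finite.intro sigma_finite_chi_measure)
  show ?thesis
    by (subst Fubini') (auto simp: mult.commute)
qed

text \<open>Passing to p = z^2 / 2, with dp = z dz, turns the chi law with \<open>2 * n\<close>
  degrees of freedom into the Gamma law of shape \<open>n\<close>, up to normalisation.\<close>

lemma chi_half_square:
  assumes [measurable]: "F \<in> borel_measurable borel" and n: "n \<ge> 1"
  shows "(\<integral>\<^sup>+z. F (z\<^sup>2 / 2) * ennreal (chi_weight (2 * n) z) \<partial>lborel) =
    (\<integral>\<^sup>+p. F p * ennreal ((2 * p) ^ (n - 1) * exp (- p)) * indicator {0<..} p \<partial>lborel)"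
proof -
  have img: "(\<lambda>z. z\<^sup>2 / 2) ` {0<..} = {0::real<..}"
  proof (intro equalityI subsetI)
    fix p :: real assume "p \<in> {0<..}"
    then show "p \<in> (\<lambda>z. z\<^sup>2 / 2) ` {0<..}"
      by (intro image_eqI[of _ _ "sqrt (2 * p)"]) auto
  qed auto
  have "(\<integral>\<^sup>+p. F p * ennreal ((2 * p) ^ (n - 1) * exp (- p)) * indicator {0<..} p \<partial>lborel) =
    (\<integral>\<^sup>+z. F (z\<^sup>2 / 2) * ennreal ((2 * (z\<^sup>2 / 2)) ^ (n - 1) * exp (- (z\<^sup>2 / 2))) * ennreal z * indicator {0<..} z \<partial>lborel)"
    by (rule nn_integral_substitution_pos[symmetric, OF _ _ _ _ _ _ img])
      (auto intro!: derivative_eq_intros continuous_intros)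
  also have "\<dots> = (\<integral>\<^sup>+z. F (z\<^sup>2 / 2) * ennreal (chi_weight (2 * n) z) \<partial>lborel)"
  proof (rule nn_integral_cong)
    fix z :: real
    obtain m where m: "n = Suc m" using n by (cases n) auto
    show "F (z\<^sup>2 / 2) * ennreal ((2 * (z\<^sup>2 / 2)) ^ (n - 1) * exp (- (z\<^sup>2 / 2))) * ennreal z * indicator {0<..} z =
      F (z\<^sup>2 / 2) * ennreal (chi_weight (2 * n) z)"
      by (cases "z > 0")
        (simp_all add: chi_weight_def m ennreal_mult' power_mult power2_eq_square power_mult_distrib mult_ac)
  qed
  finally show ?thesis ..
qed

text \<open>A probabilistic form of Legendre's duplication formula. Adding the integrals for the two
  orders of the factors produces the weight 1 + p / x^2 that the Cauchy-Schloemilch integral asks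
  for.\<close>

lemma chi_duplication:
  assumes F: "F \<in> borel_measurable borel" and n: "n \<ge> 1"
  shows "(\<integral>\<^sup>+x. (\<integral>\<^sup>+y. F (x * y) \<partial>chi_measure (Suc n)) \<partial>chi_measure n) = (\<integral>\<^sup>+z. F (z\<^sup>2 / 2) \<partial>chi_measure (2 * n))"
proof -
  define d where "d = ennreal (1 / chi_mass (Suc n)) * ennreal (1 / chi_mass n)"
  define c where "c = ennreal (1 / 2) * d * ennreal (sqrt (2 * pi)) * ennreal ((1 / 2) ^ (n - 1)) * ennreal (chi_mass (2 * n))"
  obtain m where m: "n = Suc m" using n by (cases n) auto
  have norm: "(\<integral>\<^sup>+x. (\<integral>\<^sup>+y. F (x * y) \<partial>chi_measure l) \<partial>chi_measure k) = ennreal (1 / chi_mass l) * ennreal (1 / chi_mass k) *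
     (\<integral>\<^sup>+x. (\<integral>\<^sup>+y. F (x * y) * ennreal (chi_weight l y) \<partial>lborel) * ennreal (chi_weight k x) \<partial>lborel)"
    if [measurable]: "F \<in> borel_measurable borel" for k l and F :: "real \<Rightarrow> ennreal"
    by (simp add: nn_integral_chi_measure mult.assoc nn_integral_cmult mult.left_commute)
  \<comment> \<open>The identity is first proved for all \<open>F\<close> up to the constant
    \<open>c\<close>; the constant function 1 then forces \<open>c = 1\<close>, so no Gamma values
    are computed.\<close>
  have eq: "(\<integral>\<^sup>+x. (\<integral>\<^sup>+y. F (x * y) \<partial>chi_measure (Suc n)) \<partial>chi_measure n) = c * (\<integral>\<^sup>+z. F (z\<^sup>2 / 2) \<partial>chi_measure (2 * n))"
    if [measurable]: "F \<in> borel_measurable borel" for F :: "real \<Rightarrow> ennreal"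
  proof -
    let ?L = "\<integral>\<^sup>+x. (\<integral>\<^sup>+y. F (x * y) \<partial>chi_measure (Suc n)) \<partial>chi_measure n"
    define A where "A k l p x = ennreal (x ^ (k - 1) * (p / x) ^ (l - 1) / x * exp (- (x - p / x)\<^sup>2 / 2)) * indicator {0<..} x" for k l :: nat and p x :: real
    have [measurable]: "case_prod (A k l) \<in> borel_measurable (borel \<Otimes>\<^sub>M borel)" for k l
      unfolding A_def by measurable
    have L: "ennreal (1 / chi_mass l) * ennreal (1 / chi_mass k) *
       (\<integral>\<^sup>+x. (\<integral>\<^sup>+y. F (x * y) * ennreal (chi_weight l y) \<partial>lborel) * ennreal (chi_weight k x) \<partial>lborel) =
       ennreal (1 / chi_mass l) * ennreal (1 / chi_mass k) * (\<integral>\<^sup>+p. (\<integral>\<^sup>+x. F p * ennreal (exp (- p)) * A k l p x \<partial>lborel) * indicator {0<..} p \<partial>lborel)" for k l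
      unfolding chi_product_weight[OF that] A_def by (simp add: mult.assoc)
    \<comment> \<open>One copy has its factors exchanged by \<open>chi_product_commute\<close>.
      Apart from the common exponential, the two weights in \<open>x\<close> are p^(n-1) p / x^2 and
      p^(n-1).\<close>
    have "?L + ?L = d * (\<integral>\<^sup>+p. (\<integral>\<^sup>+x. F p * ennreal (exp (- p)) * A n (Suc n) p x \<partial>lborel) * indicator {0<..} p \<partial>lborel) +
        d * (\<integral>\<^sup>+p. (\<integral>\<^sup>+x. F p * ennreal (exp (- p)) * A (Suc n) n p x \<partial>lborel) * indicator {0<..} p \<partial>lborel)"
      apply (subst (2) chi_product_commute[OF that])
      unfolding norm[OF that] L d_def by (simp add: mult_ac)
    also have "\<dots> = d * (\<integral>\<^sup>+p. (\<integral>\<^sup>+x. F p * ennreal (exp (- p)) * (A n (Suc n) p x + A (Suc n) n p x) \<partial>lborel) * indicator {0<..} p \<partial>lborel)"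
      by (simp add: distrib_left distrib_right nn_integral_add)
    also have "\<dots> = d * (\<integral>\<^sup>+p. ennreal (sqrt (2 * pi)) * ennreal ((1 / 2) ^ (n - 1)) * (F p * ennreal ((2 * p) ^ (n - 1) * exp (- p)) * indicator {0<..} p) \<partial>lborel)"
    proof (rule arg_cong2[where f="(*)", OF refl nn_integral_cong])
      fix p :: real
      show "(\<integral>\<^sup>+x. F p * ennreal (exp (- p)) * (A n (Suc n) p x + A (Suc n) n p x) \<partial>lborel) * indicator {0<..} p =
        ennreal (sqrt (2 * pi)) * ennreal ((1 / 2) ^ (n - 1)) * (F p * ennreal ((2 * p) ^ (n - 1) * exp (- p)) * indicator {0<..} p)"
      proof (cases "p > 0")
        case True
        have "A n (Suc n) p x + A (Suc n) n p x = ennreal (p ^ (n - 1)) * (ennreal (exp (- (x - p / x)\<^sup>2 / 2) * (1 + p / x\<^sup>2)) * indicator {0<..} x)" for x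
        proof (cases "x > 0")
          case x: True
          define e where "e = exp (- (x - p / x)\<^sup>2 / 2)"
          have "x ^ (n - 1) * (p / x) ^ n / x + x ^ n * (p / x) ^ (n - 1) / x = p ^ (n - 1) * (1 + p / x\<^sup>2)"
            using x by (simp add: m field_simps power2_eq_square)
          then have "x ^ (n - 1) * (p / x) ^ n / x * e + x ^ n * (p / x) ^ (n - 1) / x * e = p ^ (n - 1) * (e * (1 + p / x\<^sup>2))"
            unfolding distrib_right[symmetric] by (simp add: mult_ac)
          moreover have "e > 0" by (simp add: e_def)
          ultimately show ?thesis
            using x True unfolding A_def e_def[symmetric]
            by (simp flip: ennreal_plus ennreal_mult')
        qed (simp add: A_def)
        then have "(\<integral>\<^sup>+x. F p * ennreal (exp (- p)) * (A n (Suc n) p x + A (Suc n) n p x) \<partial>lborel) =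
          F p * ennreal (exp (- p)) * (ennreal (p ^ (n - 1)) * ennreal (sqrt (2 * pi)))"
          by (simp add: nn_integral_cmult nn_integral_exp_cauchy_schloemilch[OF True, simplified])
        moreover have "ennreal ((1 / 2) ^ (n - 1)) * ennreal ((2 * p) ^ (n - 1) * exp (- p)) = ennreal (exp (- p)) * ennreal (p ^ (n - 1))"
          using True by (simp flip: ennreal_mult') (simp add: power_mult_distrib field_simps power_one_over)
        ultimately show ?thesis using True by (simp add: mult.assoc) (simp add: mult_ac)
      qed simp
    qed
    also have "\<dots> = d * (ennreal (sqrt (2 * pi)) * ennreal ((1 / 2) ^ (n - 1)) * (\<integral>\<^sup>+z. F (z\<^sup>2 / 2) * ennreal (chi_weight (2 * n) z) \<partial>lborel))"
      unfolding chi_half_square[OF that n] by (subst nn_integral_cmult) simp_all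
    also have "(\<integral>\<^sup>+z. F (z\<^sup>2 / 2) * ennreal (chi_weight (2 * n) z) \<partial>lborel) = ennreal (chi_mass (2 * n)) * (\<integral>\<^sup>+z. F (z\<^sup>2 / 2) \<partial>chi_measure (2 * n))"
      using chi_mass_pos[of "2 * n"]
      by (simp add: nn_integral_chi_measure flip: mult.assoc ennreal_mult')
    finally have "?L + ?L = d * (ennreal (sqrt (2 * pi)) * ennreal ((1 / 2) ^ (n - 1)) * (ennreal (chi_mass (2 * n)) * (\<integral>\<^sup>+z. F (z\<^sup>2 / 2) \<partial>chi_measure (2 * n))))" .
    moreover have "ennreal (1 / 2) * (?L + ?L) = ?L"
    proof -
      have "ennreal (1 / 2) * 2 = ennreal (1 / 2 * 2)"
        by (subst ennreal_mult') auto
      then show ?thesis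
        unfolding mult_2[symmetric] mult.assoc[symmetric] by simp
    qed
    ultimately show ?thesis by (simp add: c_def mult_ac)
  qed
  interpret X: prob_space "chi_measure n" by (rule prob_space_chi_measure)
  interpret Y: prob_space "chi_measure (Suc n)" by (rule prob_space_chi_measure)
  interpret Z: prob_space "chi_measure (2 * n)" by (rule prob_space_chi_measure)
  have "c = 1"
    using eq[of "\<lambda>_. 1"] X.emeasure_space_1 Y.emeasure_space_1 Z.emeasure_space_1 by simp
  then show ?thesis using eq[OF F] by simp
qed

section \<open>Standard normal variables and their moduli\<close>

abbreviation std_normal :: "real measure" where
  "std_normal \<equiv> density lborel std_normal_density"

lemma prob_space_std_normal: "prob_space std_normal"
  by (rule prob_space_normal_density) simp

lemma nn_integral_std_normal_uminus:
  assumes [measurable]: "F \<in> borel_measurable borel"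
  shows "(\<integral>\<^sup>+x. F (- x) \<partial>std_normal) = (\<integral>\<^sup>+x. F x \<partial>std_normal)"
  using nn_integral_real_affine[of "\<lambda>x. ennreal (std_normal_density x) * F x" "-1" 0]
  by (simp add: nn_integral_density std_normal_density_def)

text \<open>Folding at 0 doubles the density on the positive half-line; the constant
  \<open>c\<close> is again found by comparing total masses.\<close>

lemma nn_integral_std_normal_abs:
  assumes [measurable]: "F \<in> borel_measurable borel"
  shows "(\<integral>\<^sup>+x. F \<bar>x\<bar> \<partial>std_normal) = (\<integral>\<^sup>+x. F x \<partial>chi_measure 1)"
proof -
  define c where "c = 2 * ennreal (1 / sqrt (2 * pi)) * ennreal (chi_mass 1)"
  have eq: "(\<integral>\<^sup>+x. F \<bar>x\<bar> \<partial>std_normal) = c * (\<integral>\<^sup>+x. F x \<partial>chi_measure 1)"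
    if [measurable]: "F \<in> borel_measurable borel" for F :: "real \<Rightarrow> ennreal"
  proof -
    define h where "h x = ennreal (std_normal_density x) * F \<bar>x\<bar> * indicator {0<..} x" for x
    have [measurable]: "h \<in> borel_measurable borel" unfolding h_def by measurable
    have "(\<integral>\<^sup>+x. F \<bar>x\<bar> \<partial>std_normal) = (\<integral>\<^sup>+x. ennreal (std_normal_density x) * F \<bar>x\<bar> \<partial>lborel)"
      by (simp add: nn_integral_density)
    also have "\<dots> = (\<integral>\<^sup>+x. h x + h (- x) \<partial>lborel)"
    proof (rule nn_integral_cong_AE)
      show "AE x in lborel. ennreal (std_normal_density x) * F \<bar>x\<bar> = h x + h (- x)"
        using AE_lborel_singleton[of 0]
        by eventually_elim (auto simp: h_def std_normal_density_def indicator_def)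
    qed
    also have "\<dots> = 2 * (\<integral>\<^sup>+x. h x \<partial>lborel)"
      using nn_integral_real_affine[of h "-1" 0] by (simp add: nn_integral_add flip: mult_2)
    also have "(\<integral>\<^sup>+x. h x \<partial>lborel) = (\<integral>\<^sup>+x. ennreal (1 / sqrt (2 * pi)) * (F x * ennreal (chi_weight 1 x)) \<partial>lborel)"
    proof (rule nn_integral_cong)
      fix x :: real
      have "ennreal (std_normal_density x) = ennreal (1 / sqrt (2 * pi)) * ennreal (chi_weight 1 x)" if "x > 0"
        using that by (simp add: std_normal_density_def chi_weight_def flip: ennreal_mult')
      then show "h x = ennreal (1 / sqrt (2 * pi)) * (F x * ennreal (chi_weight 1 x))"
        by (cases "x > 0") (simp_all add: h_def mult_ac del: One_nat_def, simp add: chi_weight_def)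
    qed
    also have "\<dots> = ennreal (1 / sqrt (2 * pi)) * (ennreal (chi_mass 1) * (\<integral>\<^sup>+x. F x \<partial>chi_measure 1))"
      using chi_mass_pos[of 1]
      by (subst nn_integral_cmult)
        (simp_all add: nn_integral_chi_measure mult.assoc[symmetric] ennreal_mult'[symmetric] del: One_nat_def)
    finally show ?thesis by (simp add: c_def mult.assoc)
  qed
  interpret X: prob_space "chi_measure 1" by (rule prob_space_chi_measure)
  interpret Y: prob_space std_normal by (rule prob_space_std_normal)
  have "c = 1"
    using eq[of "\<lambda>_. 1"] X.emeasure_space_1 Y.emeasure_space_1 by simp
  then show ?thesis using eq[OF assms] by simp
qed

lemma nn_integral_std_normal_scale:
  assumes [measurable]: "F \<in> borel_measurable borel" and c: "c > 0"
  shows "(\<integral>\<^sup>+x. F (c * x) \<partial>std_normal) = (\<integral>\<^sup>+s. F s * ennreal (normal_density 0 c s) \<partial>lborel)"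
proof -
  have "(\<integral>\<^sup>+s. F s * ennreal (normal_density 0 c s) \<partial>lborel) =
    (\<integral>\<^sup>+x. ennreal c * (F (c * x) * ennreal (normal_density 0 c (c * x))) \<partial>lborel)"
    using c by (subst nn_integral_real_affine[of _ c 0]) (auto simp: nn_integral_cmult)
  also have "\<dots> = (\<integral>\<^sup>+x. ennreal (std_normal_density x) * F (c * x) \<partial>lborel)"
  proof (rule nn_integral_cong)
    fix x
    have "c * normal_density 0 c (c * x) = std_normal_density x"
      using c by (simp add: normal_density_def power_mult_distrib real_sqrt_mult)
    then have "ennreal c * ennreal (normal_density 0 c (c * x)) = ennreal (std_normal_density x)"
      using c by (simp flip: ennreal_mult')
    then show "ennreal c * (F (c * x) * ennreal (normal_density 0 c (c * x))) = ennreal (std_normal_density x) * F (c * x)"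
      by (metis mult.commute mult.left_commute)
  qed
  finally show ?thesis by (simp add: nn_integral_density)
qed

text \<open>Scaling turns both factors into centred normal densities, the shift w = s + t turns the
  double integral into a convolution, and a convolution of centred normal densities is
  normal.\<close>

lemma nn_integral_std_normal_add:
  assumes [measurable]: "F \<in> borel_measurable borel" and a: "a > 0" and b: "b > 0"
  shows "(\<integral>\<^sup>+x. (\<integral>\<^sup>+y. F (a * x + b * y) \<partial>std_normal) \<partial>std_normal) =
    (\<integral>\<^sup>+u. F (sqrt (a\<^sup>2 + b\<^sup>2) * u) \<partial>std_normal)"
proof -
  let ?A = "\<lambda>s. ennreal (normal_density 0 a s)" and ?B = "\<lambda>s. ennreal (normal_density 0 b s)"
  have c: "sqrt (a\<^sup>2 + b\<^sup>2) > 0" using a b by (simp add: add_pos_pos)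
  interpret Y: prob_space std_normal by (rule prob_space_std_normal)
  have "(\<integral>\<^sup>+x. (\<integral>\<^sup>+y. F (a * x + b * y) \<partial>std_normal) \<partial>std_normal) =
    (\<integral>\<^sup>+s. (\<integral>\<^sup>+y. F (s + b * y) \<partial>std_normal) * ?A s \<partial>lborel)"
    using nn_integral_std_normal_scale[of "\<lambda>s. \<integral>\<^sup>+y. F (s + b * y) \<partial>std_normal" a] a by simp
  also have "\<dots> = (\<integral>\<^sup>+s. (\<integral>\<^sup>+t. F (s + t) * ?B t \<partial>lborel) * ?A s \<partial>lborel)"
    using nn_integral_std_normal_scale[of "\<lambda>t. F (_ + t)" b] b by simp
  also have "\<dots> = (\<integral>\<^sup>+s. (\<integral>\<^sup>+t. F (s + t) * ?B t * ?A s \<partial>lborel) \<partial>lborel)"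
    by (simp add: nn_integral_multc)
  also have "\<dots> = (\<integral>\<^sup>+t. (\<integral>\<^sup>+s. F (s + t) * ?B t * ?A s \<partial>lborel) \<partial>lborel)"
    by (rule lborel_pair.Fubini') measurable
  also have "\<dots> = (\<integral>\<^sup>+t. (\<integral>\<^sup>+w. F w * ?B t * ?A (w - t) \<partial>lborel) \<partial>lborel)"
  proof (rule nn_integral_cong)
    fix t
    show "(\<integral>\<^sup>+s. F (s + t) * ?B t * ?A s \<partial>lborel) = (\<integral>\<^sup>+w. F w * ?B t * ?A (w - t) \<partial>lborel)"
      by (subst (2) nn_integral_real_affine[of _ 1 t]) (auto simp: add.commute)
  qed
  also have "\<dots> = (\<integral>\<^sup>+w. (\<integral>\<^sup>+t. F w * ?B t * ?A (w - t) \<partial>lborel) \<partial>lborel)"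
    by (rule lborel_pair.Fubini') measurable
  also have "\<dots> = (\<integral>\<^sup>+w. F w * (\<integral>\<^sup>+t. ennreal (normal_density 0 a (w - t) * normal_density 0 b t) \<partial>lborel) \<partial>lborel)"
    by (subst nn_integral_cmult[symmetric]) (auto intro!: nn_integral_cong simp: ennreal_mult' mult_ac)
  also have "\<dots> = (\<integral>\<^sup>+w. F w * ennreal (normal_density 0 (sqrt (a\<^sup>2 + b\<^sup>2)) w) \<partial>lborel)"
    using fun_cong[OF conv_normal_density_zero_mean[OF a b]] by simp
  also have "\<dots> = (\<integral>\<^sup>+u. F (sqrt (a\<^sup>2 + b\<^sup>2) * u) \<partial>std_normal)"
    using nn_integral_std_normal_scale[OF assms(1) c] by simp
  finally show ?thesis .
qed

text \<open>The variable \<open>n\<close> is positive, but the symmetry of \<open>a\<close> makes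
  the inner integral even in \<open>n\<close>. So \<open>n\<close> may be replaced by a signed
  standard normal, and a sum of two independent normals remains.\<close>

lemma nn_integral_std_normal_diff_chi:
  assumes [measurable]: "F \<in> borel_measurable borel" and x: "x > 0" and b: "b > 0"
  shows "(\<integral>\<^sup>+n. (\<integral>\<^sup>+a. F \<bar>a * x - n * b\<bar> \<partial>std_normal) \<partial>chi_measure 1) =
    (\<integral>\<^sup>+u. F (u * sqrt (x\<^sup>2 + b\<^sup>2)) \<partial>chi_measure 1)"
proof -
  interpret N: prob_space std_normal by (rule prob_space_std_normal)
  interpret NN: pair_sigma_finite std_normal std_normal by standard
  define G where "G n = (\<integral>\<^sup>+a. F \<bar>a * x - n * b\<bar> \<partial>std_normal)" for n
  have [measurable]: "G \<in> borel_measurable borel"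
    unfolding G_def by measurable
  have even: "G (- n) = G n" for n
  proof -
    have "G (- n) = (\<integral>\<^sup>+a. F \<bar>- a * x + n * b\<bar> \<partial>std_normal)"
      unfolding G_def by (subst nn_integral_std_normal_uminus[symmetric]) auto
    also have "\<dots> = G n"
      unfolding G_def by (intro nn_integral_cong arg_cong[where f=F]) (simp add: abs_minus_commute)
    finally show ?thesis .
  qed
  have "(\<integral>\<^sup>+n. G n \<partial>chi_measure 1) = (\<integral>\<^sup>+n. G \<bar>n\<bar> \<partial>std_normal)"
    by (rule nn_integral_std_normal_abs[symmetric]) simp
  also have "\<dots> = (\<integral>\<^sup>+n. G (- n) \<partial>std_normal)"
    by (intro nn_integral_cong) (auto simp: abs_if even)
  also have "\<dots> = (\<integral>\<^sup>+n. (\<integral>\<^sup>+a. F \<bar>b * n + x * a\<bar> \<partial>std_normal) \<partial>std_normal)"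
    unfolding G_def by (intro nn_integral_cong) (simp add: mult.commute add.commute)
  also have "\<dots> = (\<integral>\<^sup>+u. F \<bar>sqrt (b\<^sup>2 + x\<^sup>2) * u\<bar> \<partial>std_normal)"
    using nn_integral_std_normal_add[of "\<lambda>s. F \<bar>s\<bar>" b x] x b by simp
  also have "\<dots> = (\<integral>\<^sup>+u. F (\<bar>u\<bar> * sqrt (x\<^sup>2 + b\<^sup>2)) \<partial>std_normal)"
    by (intro nn_integral_cong) (simp add: abs_mult mult.commute add.commute)
  also have "\<dots> = (\<integral>\<^sup>+u. F (u * sqrt (x\<^sup>2 + b\<^sup>2)) \<partial>chi_measure 1)"
    by (rule nn_integral_std_normal_abs) simp
  finally show ?thesis by (simp add: G_def)
qed

section \<open>The ratio law and the one-dimensional recursion\<close>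

text \<open>The limiting case of \<^const>\<open>cos_measure\<close> at \<open>j = 0\<close> is a point mass at \<open>1\<close>.\<close>

definition ratio_measure :: "nat \<Rightarrow> real measure" where
  "ratio_measure n = (if n div 2 = 0 then return borel 1 else cos_measure (2 * (n div 2)))"

lemma sets_ratio_measure [simp, measurable_cong]: "sets (ratio_measure k) = sets borel"
  by (simp add: ratio_measure_def)

lemma prob_space_ratio_measure: "prob_space (ratio_measure n)"
  by (auto simp: ratio_measure_def intro!: prob_space_return prob_space_cos_measure)

text \<open>For \<open>n div 2 = 0\<close> the ratio is 1 and the outer law already has one degree
  of freedom; otherwise the ratio is the cosine that belongs to a radius with
  \<open>2 * (n div 2) + 1\<close> degrees of freedom.\<close>

lemma ratio_measure_times_chi:
  assumes [measurable]: "F \<in> borel_measurable borel"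
  shows "(\<integral>\<^sup>+z. (\<integral>\<^sup>+v. F (z * v) \<partial>ratio_measure n) \<partial>chi_measure (2 * (n div 2) + 1)) = (\<integral>\<^sup>+a. F a \<partial>chi_measure 1)"
  using cos_measure_times_chi[OF assms, of "2 * (n div 2)"]
  by (auto simp: ratio_measure_def nn_integral_return mult.commute)

text \<open>Duplication splits z^2 / 2 into chi factors with \<open>n\<close> and
  \<open>n + 1\<close> degrees of freedom. The odd one of these numbers is
  \<open>2 * (n div 2) + 1\<close>, so that factor times the ratio is a chi variable with 1 degree
  of freedom; the even one is \<open>2 * (Suc n div 2)\<close>.\<close>

lemma half_square_times_ratio:
  assumes [measurable]: "F \<in> borel_measurable borel" and n: "n \<ge> 1"
  shows "(\<integral>\<^sup>+z. (\<integral>\<^sup>+v. F (z\<^sup>2 / 2 * v) \<partial>ratio_measure n) \<partial>chi_measure (2 * n)) =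
    (\<integral>\<^sup>+b. (\<integral>\<^sup>+m. F (m * b) \<partial>chi_measure 1) \<partial>chi_measure (2 * (Suc n div 2)))"
proof -
  interpret V: prob_space "ratio_measure n" by (rule prob_space_ratio_measure)
  define G where "G p = (\<integral>\<^sup>+v. F (p * v) \<partial>ratio_measure n)" for p
  have [measurable]: "G \<in> borel_measurable borel" unfolding G_def by measurable
  have "(\<integral>\<^sup>+z. G (z\<^sup>2 / 2) \<partial>chi_measure (2 * n)) =
    (\<integral>\<^sup>+x. (\<integral>\<^sup>+y. G (x * y) \<partial>chi_measure (Suc n)) \<partial>chi_measure n)"
    by (rule chi_duplication[symmetric]) (use n in auto)
  also have "\<dots> = (\<integral>\<^sup>+b. (\<integral>\<^sup>+z. G (b * z) \<partial>chi_measure (2 * (n div 2) + 1)) \<partial>chi_measure (2 * (Suc n div 2)))"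
  \<comment> \<open>The even factor has to be the outer one, so for odd \<open>n\<close> the two are
    exchanged.\<close>
  proof (cases "even n")
    case True
    then show ?thesis by (auto elim!: evenE)
  next
    case False
    then show ?thesis
      by (subst chi_product_commute) (auto elim!: oddE)
  qed
  also have "\<dots> = (\<integral>\<^sup>+b. (\<integral>\<^sup>+m. F (m * b) \<partial>chi_measure 1) \<partial>chi_measure (2 * (Suc n div 2)))"
  proof (rule nn_integral_cong)
    fix b :: real
    show "(\<integral>\<^sup>+z. G (b * z) \<partial>chi_measure (2 * (n div 2) + 1)) = (\<integral>\<^sup>+m. F (m * b) \<partial>chi_measure 1)"
      using ratio_measure_times_chi[of "\<lambda>m. F (m * b)" n] by (simp add: G_def mult_ac)
  qed
  finally show ?thesis by (simp add: G_def)
qed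

lemma AE_chi_measure_pos: "AE x in chi_measure k. x > 0"
  unfolding chi_measure_def by (simp add: AE_density chi_density_eq chi_weight_def)

text \<open>The one-dimensional recursion behind the theorem: it describes how the moduli of two
  consecutive leading principal minors evolve when a row is added.\<close>

lemma minor_recursion:
  assumes F [measurable]: "case_prod F \<in> borel_measurable (borel \<Otimes>\<^sub>M borel)" and n: "n \<ge> 1"
  shows "(\<integral>\<^sup>+a. (\<integral>\<^sup>+z. (\<integral>\<^sup>+x. (\<integral>\<^sup>+v. F \<bar>a * x - z\<^sup>2 / 2 * v\<bar> x \<partial>ratio_measure n) \<partial>chi_measure 1) \<partial>chi_measure (2 * n)) \<partial>std_normal) =
    (\<integral>\<^sup>+z. (\<integral>\<^sup>+x. (\<integral>\<^sup>+v. F (x * z) (v * z) \<partial>ratio_measure (Suc n)) \<partial>chi_measure 1) \<partial>chi_measure (2 * (Suc n div 2) + 1))"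
proof -
  define j where "j = 2 * (Suc n div 2)"
  have j: "j \<ge> 1" "ratio_measure (Suc n) = cos_measure j"
    using n by (auto simp: j_def ratio_measure_def)
  interpret V: prob_space "ratio_measure n" by (rule prob_space_ratio_measure)
  interpret W: prob_space "ratio_measure (Suc n)" by (rule prob_space_ratio_measure)
  interpret N: prob_space std_normal by (rule prob_space_std_normal)
  interpret C: prob_space "chi_measure k" for k by (rule prob_space_chi_measure)
  interpret Z1: pair_sigma_finite "chi_measure (2 * n)" "chi_measure 1" by standard
  interpret A1: pair_sigma_finite std_normal "chi_measure 1" by standard
  interpret A2: pair_sigma_finite std_normal "chi_measure j" by standard
  have "(\<integral>\<^sup>+a. (\<integral>\<^sup>+z. (\<integral>\<^sup>+x. (\<integral>\<^sup>+v. F \<bar>a * x - z\<^sup>2 / 2 * v\<bar> x \<partial>ratio_measure n) \<partial>chi_measure 1) \<partial>chi_measure (2 * n)) \<partial>std_normal) =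
    (\<integral>\<^sup>+a. (\<integral>\<^sup>+x. (\<integral>\<^sup>+z. (\<integral>\<^sup>+v. F \<bar>a * x - z\<^sup>2 / 2 * v\<bar> x \<partial>ratio_measure n) \<partial>chi_measure (2 * n)) \<partial>chi_measure 1) \<partial>std_normal)"
    by (intro nn_integral_cong Z1.Fubini'[symmetric]) measurable
  \<comment> \<open>With \<open>a\<close> and \<open>x\<close> held fixed, the Gamma variable times
    the ratio is traded for the product \<open>m * b\<close>.\<close>
  also have "\<dots> = (\<integral>\<^sup>+a. (\<integral>\<^sup>+x. (\<integral>\<^sup>+b. (\<integral>\<^sup>+m. F \<bar>a * x - m * b\<bar> x \<partial>chi_measure 1) \<partial>chi_measure j) \<partial>chi_measure 1) \<partial>std_normal)"
    unfolding j_def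
    by (intro nn_integral_cong half_square_times_ratio[where F="\<lambda>p. F \<bar>_ * _ - p\<bar> _"] n) measurable
  also have "\<dots> = (\<integral>\<^sup>+x. (\<integral>\<^sup>+a. (\<integral>\<^sup>+b. (\<integral>\<^sup>+m. F \<bar>a * x - m * b\<bar> x \<partial>chi_measure 1) \<partial>chi_measure j) \<partial>std_normal) \<partial>chi_measure 1)"
    by (rule A1.Fubini'[symmetric]) measurable
  also have "\<dots> = (\<integral>\<^sup>+x. (\<integral>\<^sup>+b. (\<integral>\<^sup>+a. (\<integral>\<^sup>+m. F \<bar>a * x - m * b\<bar> x \<partial>chi_measure 1) \<partial>std_normal) \<partial>chi_measure j) \<partial>chi_measure 1)"
    by (intro nn_integral_cong A2.Fubini'[symmetric]) measurable
  also have "\<dots> = (\<integral>\<^sup>+x. (\<integral>\<^sup>+b. (\<integral>\<^sup>+m. (\<integral>\<^sup>+a. F \<bar>a * x - m * b\<bar> x \<partial>std_normal) \<partial>chi_measure 1) \<partial>chi_measure j) \<partial>chi_measure 1)"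
    by (intro nn_integral_cong A1.Fubini'[symmetric]) measurable
  also have "\<dots> = (\<integral>\<^sup>+x. (\<integral>\<^sup>+b. (\<integral>\<^sup>+u. F (u * sqrt (x\<^sup>2 + b\<^sup>2)) x \<partial>chi_measure 1) \<partial>chi_measure j) \<partial>chi_measure 1)"
  \<comment> \<open>Combining the two normals asks for strictly positive \<open>x\<close> and
    \<open>b\<close>, which holds almost surely.\<close>
  proof (rule nn_integral_cong_AE)
    show "AE x in chi_measure 1. (\<integral>\<^sup>+b. (\<integral>\<^sup>+m. (\<integral>\<^sup>+a. F \<bar>a * x - m * b\<bar> x \<partial>std_normal) \<partial>chi_measure 1) \<partial>chi_measure j) =
      (\<integral>\<^sup>+b. (\<integral>\<^sup>+u. F (u * sqrt (x\<^sup>2 + b\<^sup>2)) x \<partial>chi_measure 1) \<partial>chi_measure j)"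
      using AE_chi_measure_pos
    proof eventually_elim
      fix x :: real assume x: "x > 0"
      show "(\<integral>\<^sup>+b. (\<integral>\<^sup>+m. (\<integral>\<^sup>+a. F \<bar>a * x - m * b\<bar> x \<partial>std_normal) \<partial>chi_measure 1) \<partial>chi_measure j) =
      (\<integral>\<^sup>+b. (\<integral>\<^sup>+u. F (u * sqrt (x\<^sup>2 + b\<^sup>2)) x \<partial>chi_measure 1) \<partial>chi_measure j)"
      proof (rule nn_integral_cong_AE)
        show "AE b in chi_measure j. (\<integral>\<^sup>+m. (\<integral>\<^sup>+a. F \<bar>a * x - m * b\<bar> x \<partial>std_normal) \<partial>chi_measure 1) =
          (\<integral>\<^sup>+u. F (u * sqrt (x\<^sup>2 + b\<^sup>2)) x \<partial>chi_measure 1)"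
          using AE_chi_measure_pos
        proof eventually_elim
          fix b :: real assume "b > 0"
          then show "(\<integral>\<^sup>+m. (\<integral>\<^sup>+a. F \<bar>a * x - m * b\<bar> x \<partial>std_normal) \<partial>chi_measure 1) =
            (\<integral>\<^sup>+u. F (u * sqrt (x\<^sup>2 + b\<^sup>2)) x \<partial>chi_measure 1)"
            using nn_integral_std_normal_diff_chi[where F="\<lambda>y. F y x", OF _ x] by simp
        qed
      qed
    qed
  qed
  \<comment> \<open>The new chi factor \<open>u\<close> is integrated inside the test function, so
    polar coordinates act on the pair (x, b) only.\<close>
  also have "\<dots> = (\<integral>\<^sup>+z. (\<integral>\<^sup>+v. (\<integral>\<^sup>+u. F (u * z) (v * z) \<partial>chi_measure 1) \<partial>ratio_measure (Suc n)) \<partial>chi_measure (Suc j))"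
    unfolding j(2) by (rule chi_polar[where F="\<lambda>z x. \<integral>\<^sup>+u. F (u * z) x \<partial>chi_measure 1"]) (use j in measurable)
  also have "\<dots> = (\<integral>\<^sup>+z. (\<integral>\<^sup>+u. (\<integral>\<^sup>+v. F (u * z) (v * z) \<partial>ratio_measure (Suc n)) \<partial>chi_measure 1) \<partial>chi_measure (Suc j))"
  proof -
    interpret R: pair_sigma_finite "chi_measure 1" "ratio_measure (Suc n)" by standard
    show ?thesis by (intro nn_integral_cong R.Fubini') measurable
  qed
  finally show ?thesis by (simp add: j_def)
qed

section \<open>Principal minors and unitary conjugation\<close>

text \<open>The principal submatrix indexed by \<open>S\<close>, padded with an identity block: its determinant is the
  principal minor, and minors of all sizes live in one matrix type.\<close>

definition principal :: "'n set \<Rightarrow> complex^'n^'n \<Rightarrow> complex^'n^'n" where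
  "principal S M = (\<chi> i j. if i \<in> S \<and> j \<in> S then M $ i $ j else if i = j then 1 else 0)"

definition outer :: "complex^'n \<Rightarrow> complex^'m \<Rightarrow> complex^'m^'n" where
  "outer v w = (\<chi> i j. v $ i * cnj (w $ j))"

definition unitary :: "complex^'n^'n \<Rightarrow> bool" where
  "unitary U \<longleftrightarrow> conj_transpose U ** U = mat 1 \<and> U ** conj_transpose U = mat 1"

definition supported_on :: "'n set \<Rightarrow> complex^'n^'n \<Rightarrow> bool" where
  "supported_on S U \<longleftrightarrow> (\<forall>i j. i \<notin> S \<or> j \<notin> S \<longrightarrow> U $ i $ j = (if i = j then 1 else 0))"

text \<open>For a matrix \<open>A\<close> whose row and column \<open>k\<close> are those of the identity, this replaces the
  \<open>k\<close>-th column by \<open>v + a e\<^sub>k\<close> and the \<open>k\<close>-th row correspondingly; written with outer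
  products, it is visibly equivariant under conjugation by unitary matrices that fix \<open>e\<^sub>k\<close>.\<close>

definition border :: "'n \<Rightarrow> complex^'n^'n \<Rightarrow> complex^'n \<Rightarrow> complex \<Rightarrow> complex^'n^'n" where
  "border k A v a = A + outer (axis k (a - 1)) (axis k 1) + outer v (axis k 1) + outer (axis k 1) v"

section \<open>Conjugate transpose and equivariance of principal minors\<close>

lemma conj_transpose_nth [simp]: "conj_transpose A $ i $ j = cnj (A $ j $ i)"
  by (simp add: conj_transpose_def)

lemma conj_transpose_mult: "conj_transpose (A ** B) = conj_transpose B ** conj_transpose A"
  by (simp add: vec_eq_iff matrix_matrix_mult_def mult.commute)

lemma conj_transpose_conj_transpose [simp]: "conj_transpose (conj_transpose A) = A"
  by (simp add: vec_eq_iff)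

lemma conj_transpose_add: "conj_transpose (A + B) = conj_transpose A + conj_transpose B"
  by (simp add: vec_eq_iff)

lemma conj_transpose_scaleR: "conj_transpose (c *\<^sub>R A) = c *\<^sub>R conj_transpose A"
  by (simp add: vec_eq_iff)

lemma det_conj_transpose: "det (conj_transpose A) = cnj (det A)"
proof -
  have "det (conj_transpose A) = det (\<chi> i j. cnj (A $ i $ j))"
    by (subst det_transpose[symmetric]) (simp add: transpose_def conj_transpose_def)
  also have "\<dots> = cnj (det A)"
    by (simp add: det_def cnj_sum cnj_prod)
  finally show ?thesis .
qed

lemma principal_nth:
  "principal S M $ i $ j = (if i \<in> S \<and> j \<in> S then M $ i $ j else if i = j then 1 else 0)"
  by (simp add: principal_def)

lemma principal_hermitian:
  assumes "conj_transpose M = M"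
  shows "conj_transpose (principal S M) = principal S M"
proof -
  have "cnj (M $ j $ i) = M $ i $ j" for i j
    using assms by (metis conj_transpose_nth)
  then show ?thesis by (auto simp: vec_eq_iff principal_nth)
qed

lemma det_principal_real:
  assumes "conj_transpose M = M"
  shows "det (principal S M) = of_real (Re (det (principal S M)))"
proof -
  have "cnj (det (principal S M)) = det (principal S M)"
    using det_conj_transpose[of "principal S M"] principal_hermitian[OF assms] by simp
  then show ?thesis by (simp add: complex_eq_iff)
qed

lemma outer_mult_left: "U ** outer v w = outer (U *v v) w"
  by (simp add: vec_eq_iff matrix_matrix_mult_def matrix_vector_mult_def outer_def sum_distrib_right mult.assoc)

lemma outer_mult_right: "outer v w ** conj_transpose U = outer v (U *v w)"
  by (simp add: vec_eq_iff matrix_matrix_mult_def matrix_vector_mult_def outer_def sum_distrib_left cnj_sum mult_ac)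

lemma matrix_mult_distrib_right: "(A + B) ** C = A ** C + B ** (C :: complex^'n^'n)"
  by (simp add: vec_eq_iff matrix_matrix_mult_def sum.distrib distrib_right)

lemma det_unitary_conj:
  assumes "unitary U"
  shows "det (U ** A ** conj_transpose U) = det A"
proof -
  have "det U * det (conj_transpose U) = 1"
    using assms by (simp add: unitary_def flip: det_mul)
  then show ?thesis by (simp add: det_mul)
qed

lemma supported_on_conj_transpose:
  "supported_on S U \<Longrightarrow> supported_on S (conj_transpose U)"
  by (auto simp: supported_on_def)

text \<open>In terms of coordinate projections the padded submatrix is
  \<open>P S ** A ** P S + P (- S)\<close>. A matrix supported on \<open>S\<close> commutes with
  \<open>P S\<close> and leaves \<open>P (- S)\<close> unchanged under multiplication from either
  side, so conjugation passes through both summands.\<close>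

lemma principal_conj:
  fixes M :: "complex^'n^'n"
  assumes U: "supported_on S U"
  shows "principal S (U ** M ** conj_transpose U) = U ** principal S M ** conj_transpose U"
proof -
  define P :: "'n set \<Rightarrow> complex^'n^'n" where "P T = (\<chi> i j. if i = j \<and> i \<in> T then 1 else 0)" for T
  have mulP: "(A ** P T) $ i $ j = (if j \<in> T then A $ i $ j else 0)" for A T i j
  proof -
    have "(A ** P T) $ i $ j = (\<Sum>k\<in>UNIV. if k = j then if j \<in> T then A $ i $ j else 0 else 0)"
      unfolding matrix_matrix_mult_def P_def vec_lambda_beta by (intro sum.cong) auto
    then show ?thesis by simp
  qed
  have Pmul: "(P T ** A) $ i $ j = (if i \<in> T then A $ i $ j else 0)" for A T i j
  proof -
    have "(P T ** A) $ i $ j = (\<Sum>k\<in>UNIV. if k = i then if i \<in> T then A $ i $ j else 0 else 0)"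
      unfolding matrix_matrix_mult_def P_def vec_lambda_beta by (intro sum.cong) auto
    then show ?thesis by simp
  qed
  have Pnth: "P T $ i $ j = (if i = j \<and> i \<in> T then 1 else 0)" for T i j
    by (simp add: P_def)
  have pr: "principal S A = P S ** A ** P S + P (- S)" for A
    by (simp add: vec_eq_iff mulP Pmul) (auto simp: principal_nth Pnth)
  have comm: "V ** P S = P S ** V" "V ** P (- S) = P (- S)" "P (- S) ** V = P (- S)"
    if "supported_on S V" for V
    using that by (auto simp: vec_eq_iff mulP Pmul supported_on_def Pnth)
  note U' = supported_on_conj_transpose[OF U]
  have "P S ** (U ** M ** conj_transpose U) ** P S = U ** (P S ** M ** P S) ** conj_transpose U"
    by (metis comm(1)[OF U] comm(1)[OF U'] matrix_mul_assoc)
  moreover have "P (- S) = U ** P (- S) ** conj_transpose U"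
    by (simp add: comm(2)[OF U] comm(3)[OF U'])
  ultimately show ?thesis
    unfolding pr by (metis matrix_add_ldistrib matrix_mult_distrib_right)
qed

text \<open>Since \<open>k\<close> lies outside \<open>S\<close>, \<open>U\<close> fixes the axis
  vectors at \<open>k\<close>; in the outer products conjugation therefore moves only
  \<open>v\<close>.\<close>

lemma border_conj:
  assumes "supported_on S U" "k \<notin> S"
  shows "border k (U ** A ** conj_transpose U) (U *v v) a = U ** border k A v a ** conj_transpose U"
proof -
  have "U *v axis k c = axis k c" for c
    using assms by (auto simp: vec_eq_iff matrix_vector_mult_def supported_on_def axis_def
        if_distrib[of "(*) _"] sum.delta cong: if_cong)
  then show ?thesis
    by (simp add: border_def matrix_add_ldistrib matrix_mult_distrib_right outer_mult_left outer_mult_right)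
qed

section \<open>Householder reflections\<close>

text \<open>The complex reflection along \<open>w\<close>. At \<open>w = 0\<close> the outer product
  vanishes and the identity is left.\<close>

definition householder :: "complex^'n \<Rightarrow> complex^'n^'n" where
  "householder w = mat 1 - outer (of_real (2 / (norm w)\<^sup>2) *s w) w"

lemma outer_mult_vector: "outer u w *v x = (\<Sum>i\<in>UNIV. cnj (w $ i) * x $ i) *s u"
  by (simp add: vec_eq_iff outer_def matrix_vector_mult_def sum_distrib_left mult_ac)

lemma sum_cnj_mult_self: "(\<Sum>i\<in>UNIV. cnj (w $ i) * w $ i) = of_real ((norm (w :: complex^'n))\<^sup>2)"
proof -
  have "(norm w)\<^sup>2 = (\<Sum>i\<in>UNIV. (cmod (w $ i))\<^sup>2)"
    by (simp add: norm_vec_def L2_set_def sum_nonneg)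
  then show ?thesis
    by (simp add: complex_norm_square mult.commute del: of_real_power flip: of_real_power)
qed

lemma householder_mult_vector:
  "householder w *v x = x - (2 * (\<Sum>i\<in>UNIV. cnj (w $ i) * x $ i) / of_real ((norm w)\<^sup>2)) *s w"
  by (simp add: householder_def matrix_vector_mult_diff_rdistrib outer_mult_vector vector_smult_assoc mult.commute)

lemma householder_hermitian: "conj_transpose (householder w) = householder w"
  by (auto simp: vec_eq_iff householder_def outer_def mat_def mult_ac)

text \<open>A reflection is its own inverse, and this one is hermitian.\<close>

lemma householder_unitary: "unitary (householder w)"
proof -
  have "householder w *v (householder w *v x) = x" for x
  proof (cases "w = 0")
    case False
    define q where "q x = (\<Sum>i\<in>UNIV. cnj (w $ i) * x $ i)" for x
    have q: "q (x - c *s w) = q x - c * of_real ((norm w)\<^sup>2)" for x c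
      unfolding q_def sum_cnj_mult_self[symmetric]
      by (simp add: algebra_simps sum_subtractf sum_distrib_left)
    show ?thesis
      unfolding householder_mult_vector q_def[symmetric] q using False
      by (simp add: vec_eq_iff)
  qed (simp add: householder_mult_vector)
  then have "householder w ** householder w = mat 1"
    by (subst matrix_eq) (simp add: matrix_vector_mul_assoc[symmetric])
  then show ?thesis by (simp add: unitary_def householder_hermitian)
qed

text \<open>The reflection along \<open>v - axis j c\<close> exchanges the two vectors when they
  have equal length and a real inner product; the phase of \<open>c\<close> is chosen for the
  latter. Their difference vanishes off \<open>S\<close>, so the reflection is supported on
  \<open>S\<close>.\<close>

lemma unitary_to_axis:
  fixes v :: "complex^'n"
  assumes v: "\<And>i. i \<notin> S \<Longrightarrow> v $ i = 0" and j: "j \<in> S"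
  obtains U c where "unitary U" "supported_on S U" "U *v v = axis j c" "cmod c = norm v"
proof -
  \<comment> \<open>Here \<open>c\<close> copies the phase of \<open>v $ j\<close>, which makes
    \<open>cnj c * v $ j\<close> the nonnegative real \<open>r\<close>. For \<open>v $ j = 0\<close>
    any phase serves.\<close>
  define c where "c = of_real (norm v) * (if v $ j = 0 then 1 else sgn (v $ j))"
  define w where "w = v - axis j c"
  define r where "r = norm v * cmod (v $ j)"
  have c: "cmod c = norm v" by (simp add: c_def norm_mult norm_sgn)
  have cv: "cnj c * v $ j = of_real r"
    by (simp add: c_def r_def sgn_eq complex_norm_square[symmetric] power2_eq_square mult_ac)
  have dotv: "(\<Sum>i\<in>UNIV. cnj (w $ i) * v $ i) = of_real ((norm v)\<^sup>2 - r)"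
  proof -
    have "(\<Sum>i\<in>UNIV. cnj (w $ i) * v $ i) = (\<Sum>i\<in>UNIV. cnj (v $ i) * v $ i) - (\<Sum>i\<in>UNIV. if i = j then cnj c * v $ j else 0)"
      unfolding sum_subtractf[symmetric] by (intro sum.cong) (auto simp: w_def axis_def algebra_simps)
    then show ?thesis by (simp add: sum_cnj_mult_self cv)
  qed
  have "of_real ((norm w)\<^sup>2) = (of_real (2 * ((norm v)\<^sup>2 - r)) :: complex)"
  proof -
    have "(\<Sum>i\<in>UNIV. cnj (w $ i) * w $ i) = (\<Sum>i\<in>UNIV. cnj (w $ i) * v $ i) - (\<Sum>i\<in>UNIV. if i = j then cnj (w $ j) * c else 0)"
      unfolding sum_subtractf[symmetric] by (intro sum.cong) (auto simp: w_def axis_def algebra_simps)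
    also have "\<dots> = of_real ((norm v)\<^sup>2 - r) - (cnj (cnj c * v $ j) - c * cnj c)"
    proof -
      have "cnj (w $ j) * c = cnj (cnj c * v $ j) - c * cnj c"
        by (simp add: w_def axis_def algebra_simps)
      then show ?thesis unfolding dotv by simp
    qed
    also have "\<dots> = of_real (2 * ((norm v)\<^sup>2 - r))"
      unfolding cv complex_norm_square[symmetric] c by simp
    finally show ?thesis by (simp add: sum_cnj_mult_self)
  qed
  then have w2: "(norm w)\<^sup>2 = 2 * ((norm v)\<^sup>2 - r)" by (simp only: of_real_eq_iff)
  have "householder w *v v = axis j c"
  proof (cases "w = 0")
    case True
    then show ?thesis by (simp add: householder_mult_vector w_def)
  next
    case False
    then have "(norm v)\<^sup>2 - r \<noteq> 0" using w2 by auto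
    then have "2 * complex_of_real ((norm v)\<^sup>2 - r) / of_real (2 * ((norm v)\<^sup>2 - r)) = 1"
      by (metis divide_self of_real_eq_0_iff of_real_mult of_real_numeral mult_eq_0_iff zero_neq_numeral)
    then show ?thesis
      unfolding householder_mult_vector dotv w2 by (simp add: w_def)
  qed
  moreover have "supported_on S (householder w)"
    using v j by (auto simp: supported_on_def householder_def w_def outer_def axis_def mat_def)
  ultimately show ?thesis using that householder_unitary c by blast
qed

section \<open>Determinants of bordered matrices\<close>

text \<open>In the Leibniz sum a permutation that moves \<open>k\<close> meets a zero in row
  \<open>k\<close>, and one that fixes \<open>k\<close> uses column \<open>k\<close> in no other
  row.\<close>

lemma det_cong_row_axis:
  fixes A B :: "'a::comm_ring_1^'n^'n"
  assumes A: "A $ k = axis k 1" and B: "B $ k = axis k 1"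
    and eq: "\<And>i j. i \<noteq> k \<Longrightarrow> j \<noteq> k \<Longrightarrow> A $ i $ j = B $ i $ j"
  shows "det A = det B"
  unfolding det_def
proof (rule sum.cong[OF refl])
  fix p assume "p \<in> {p. p permutes (UNIV :: 'n set)}"
  then have p: "p permutes UNIV" by simp
  show "of_int (sign p) * (\<Prod>i\<in>UNIV. A $ i $ p i) = of_int (sign p) * (\<Prod>i\<in>UNIV. B $ i $ p i)"
  proof (cases "p k = k")
    case True
    have "A $ i $ p i = B $ i $ p i" for i
    proof (cases "i = k")
      case False
      then have "p i \<noteq> k" using True permutes_inj[OF p] by (metis injD)
      then show ?thesis using False eq by simp
    qed (simp add: A B)
    then show ?thesis by simp
  next
    case False
    then have "A $ k $ p k = 0" "B $ k $ p k = 0" by (auto simp: A B axis_def)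
    then have "(\<Prod>i\<in>UNIV. A $ i $ p i) = 0" "(\<Prod>i\<in>UNIV. B $ i $ p i) = 0"
      by (auto intro!: prod_zero)
    then show ?thesis by simp
  qed
qed

text \<open>Expansion along row \<open>k\<close>; the cofactor is padded by the identity to stay in
  the same matrix type.\<close>

lemma det_row_axis:
  fixes A :: "'a::comm_ring_1^'n^'n"
  assumes A: "A $ k = axis k c"
  shows "det A = c * det (\<chi> i j. if i = k \<or> j = k then if i = j then 1 else 0 else A $ i $ j)"
proof -
  have "A = (\<chi> i. if i = k then c *s axis k 1 else A $ i)"
    by (auto simp: vec_eq_iff A axis_def)
  then have "det A = det (\<chi> i. if i = k then c *s axis k 1 else A $ i)"
    by (rule arg_cong[where f = det])
  also have "\<dots> = c * det (\<chi> i. if i = k then axis k 1 else A $ i)"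
    by (rule det_row_mul)
  also have "det (\<chi> i. if i = k then axis k 1 else A $ i) =
    det (\<chi> i j. if i = k \<or> j = k then if i = j then 1 else 0 else A $ i $ j)"
    by (rule det_cong_row_axis[of _ k]) (auto simp: vec_eq_iff axis_def)
  finally show ?thesis .
qed

lemma border_nth:
  assumes "k \<notin> S" "v $ k = 0"
  shows "border k (principal S M) v a $ i $ j =
    (if i = k then if j = k then a else cnj (v $ j) else if j = k then v $ i else principal S M $ i $ j)"
  using assms by (auto simp: border_def outer_def axis_def principal_nth)

text \<open>The determinant is linear in row \<open>k\<close>, and this row is \<open>a\<close>
  times an axis vector plus the row with a zero corner.\<close>

lemma det_border:
  assumes k: "k \<notin> S" and v: "v $ k = 0"
  shows "det (border k (principal S M) v a) = a * det (principal S M) + det (border k (principal S M) v 0)"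
proof -
  let ?B = "border k (principal S M) v 0"
  have "border k (principal S M) v a = (\<chi> i. if i = k then a *s axis k 1 + ?B $ k else ?B $ i)"
    using assms by (auto simp: vec_eq_iff border_nth axis_def)
  then have "det (border k (principal S M) v a) = det (\<chi> i. if i = k then a *s axis k 1 + ?B $ k else ?B $ i)"
    by (rule arg_cong[where f = det])
  also have "\<dots> = a * det (\<chi> i. if i = k then axis k 1 else ?B $ i) +
      det (\<chi> i. if i = k then ?B $ k else ?B $ i)"
    by (simp add: det_row_add det_row_mul)
  also have "(\<chi> i. if i = k then ?B $ k else ?B $ i) = ?B"
    by (simp add: vec_eq_iff)
  also have "det (\<chi> i. if i = k then axis k 1 else ?B $ i) = det (principal S M)"
    using assms by (intro det_cong_row_axis[of _ k]) (auto simp: vec_eq_iff border_nth axis_def principal_nth)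
  finally show ?thesis .
qed

text \<open>Exchanging columns \<open>j\<close> and \<open>k\<close> costs a sign and leaves
  multiples of axis vectors in row \<open>k\<close> and in column \<open>j\<close>. Expanding along
  both gives \<open>cnj c * c\<close>, and the identity padding left at \<open>j\<close> and
  \<open>k\<close> is that of \<open>S - {j}\<close>.\<close>

lemma det_border_axis:
  assumes k: "k \<notin> S" and j: "j \<in> S"
  shows "det (border k (principal S M) (axis j c) 0) = - of_real ((cmod c)\<^sup>2) * det (principal (S - {j}) M)"
proof -
  let ?B = "border k (principal S M) (axis j c) 0" and ?p = "Transposition.transpose j k"
  have jk: "j \<noteq> k" using assms by auto
  then have B: "?B $ i $ l = (if i = k then if l = j then cnj c else 0 else if l = k then if i = j then c else 0 else principal S M $ i $ l)" for i l
    using k by (subst border_nth) (auto simp: axis_def)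
  define C where "C = (\<chi> i l. ?B $ i $ ?p l)"
  have C: "C $ i $ l = (if l = k then if i = k then cnj c else principal S M $ i $ j
      else if i = k then 0 else if l = j then if i = j then c else 0 else principal S M $ i $ l)" for i l
    using jk by (auto simp: C_def B transpose_def)
  have "det C = of_int (sign ?p) * det ?B"
    unfolding C_def by (rule det_permute_columns) (simp add: permutes_swap_id)
  then have "det ?B = - det C" using jk by (simp add: sign_swap_id)
  also have "det C = cnj c * det (\<chi> i l. if i = k \<or> l = k then if i = l then 1 else 0 else C $ i $ l)"
    by (rule det_row_axis) (auto simp: vec_eq_iff C axis_def)
  \<comment> \<open>Transposing turns column \<open>j\<close> into a row for the second
    expansion.\<close>
  also have "det (\<chi> i l. if i = k \<or> l = k then if i = l then 1 else 0 else C $ i $ l) =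
    det (\<chi> i l. if l = k \<or> i = k then if l = i then 1 else 0 else C $ l $ i)"
    by (subst det_transpose[symmetric]) (simp add: transpose_def)
  also have "\<dots> = c * det (\<chi> i l. if i = j \<or> l = j then if i = l then 1 else 0 else
      (\<chi> i l. if l = k \<or> i = k then if l = i then 1 else 0 else C $ l $ i) $ i $ l)"
    by (rule det_row_axis) (use jk in \<open>auto simp: vec_eq_iff C axis_def\<close>)
  also have "(\<chi> i l. if i = j \<or> l = j then if i = l then 1 else 0 else
      (\<chi> i l. if l = k \<or> i = k then if l = i then 1 else 0 else C $ l $ i) $ i $ l) =
      Finite_Cartesian_Product.transpose (principal (S - {j}) M)"
    using k j by (auto simp: vec_eq_iff C principal_nth Finite_Cartesian_Product.transpose_def)
  finally show ?thesis
    unfolding complex_norm_square by (simp add: det_transpose mult_ac)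
qed

lemma principal_insert:
  assumes M: "conj_transpose M = M" and k: "k \<notin> S"
  shows "principal (insert k S) M = border k (principal S M) (\<chi> i. if i \<in> S then M $ i $ k else 0) (M $ k $ k)"
proof -
  have "cnj (M $ j $ i) = M $ i $ j" for i j
    using M by (metis conj_transpose_nth)
  then show ?thesis
    using k by (subst vec_eq_iff, subst vec_eq_iff, subst border_nth) (auto simp: principal_nth)
qed

lemma principal_UNIV [simp]: "principal UNIV M = M"
  by (simp add: principal_nth vec_eq_iff)

lemma principal_empty [simp]: "principal {} M = mat 1"
  by (simp add: principal_nth vec_eq_iff mat_def)

lemma det_measurable [measurable]: "det \<in> borel_measurable (borel :: (complex^'n^'n) measure)"
proof -
  have "continuous_on UNIV (det :: complex^'n^'n \<Rightarrow> complex)"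
    unfolding det_def by (intro continuous_intros)
  then show ?thesis by (rule borel_measurable_continuous_onI)
qed

section \<open>Gaussian matrices\<close>

lemma nn_integral_lborel_translate:
  fixes f :: "'a::euclidean_space \<Rightarrow> ennreal"
  assumes [measurable]: "f \<in> borel_measurable borel"
  shows "(\<integral>\<^sup>+x. f (t + x) \<partial>lborel) = (\<integral>\<^sup>+x. f x \<partial>lborel)"
proof -
  have "(\<integral>\<^sup>+x. f x \<partial>lborel) = (\<integral>\<^sup>+x. f x \<partial>density (distr lborel borel (\<lambda>x. t + 1 *\<^sub>R x)) (\<lambda>_. ennreal (\<bar>1\<bar> ^ DIM('a))))"
    by (subst lborel_affine[of 1 t]) simp_all
  then show ?thesis by (simp add: nn_integral_density nn_integral_distr)
qed

lemma nn_integral_lborel_reflect: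
  fixes f :: "'a::euclidean_space \<Rightarrow> ennreal"
  assumes [measurable]: "f \<in> borel_measurable borel"
  shows "(\<integral>\<^sup>+x. f (t - x) \<partial>lborel) = (\<integral>\<^sup>+x. f x \<partial>lborel)"
proof -
  have "(\<integral>\<^sup>+x. f x \<partial>lborel) = (\<integral>\<^sup>+x. f x \<partial>density (distr lborel borel (\<lambda>x. t + (- 1) *\<^sub>R x)) (\<lambda>_. ennreal (\<bar>- 1\<bar> ^ DIM('a))))"
    by (subst lborel_affine[of "- 1" t]) simp_all
  then show ?thesis by (simp add: nn_integral_density nn_integral_distr)
qed

text \<open>The uniqueness argument for translation-invariant measures, run directly: the double
  integral of \<open>f (T x) g y\<close> is evaluated in two ways with \<open>g\<close> the indicator of the unit ball,
  which \<open>T\<close> preserves.\<close>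

lemma nn_integral_lborel_isometry:
  fixes T :: "'a::euclidean_space \<Rightarrow> 'a"
  assumes T: "linear T" and norm: "\<And>x. norm (T x) = norm x"
    and f [measurable]: "f \<in> borel_measurable borel"
  shows "(\<integral>\<^sup>+x. f (T x) \<partial>lborel) = (\<integral>\<^sup>+x. f x \<partial>lborel)"
proof -
  define g :: "'a \<Rightarrow> ennreal" where "g = indicator (ball 0 1)"
  have [measurable]: "g \<in> borel_measurable borel" unfolding g_def by (intro borel_measurable_indicator) simp
  have [measurable]: "T \<in> borel_measurable borel"
    using T by (intro borel_measurable_continuous_onI linear_continuous_on linear_conv_bounded_linear[THEN iffD1])
  have "inj T"
    using T norm by (simp add: linear_injective_0) (metis norm_eq_zero)
  then have surj: "surj T" using T by (simp add: linear_injective_imp_surjective)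
  let ?c = "\<integral>\<^sup>+x. g x \<partial>lborel"
  have c: "?c = emeasure lborel (ball (0::'a) 1)" by (simp add: g_def)
  have gT: "(\<integral>\<^sup>+x. g (T x) \<partial>lborel) = ?c"
    by (intro nn_integral_cong) (simp add: g_def indicator_def norm)
  have "(\<integral>\<^sup>+x. f (T x) \<partial>lborel) * ?c = (\<integral>\<^sup>+x. (\<integral>\<^sup>+y. f (T x) * g y \<partial>lborel) \<partial>lborel)"
    by (simp add: nn_integral_multc nn_integral_cmult)
  also have "\<dots> = (\<integral>\<^sup>+x. (\<integral>\<^sup>+y. f (T x) * g (T x + y) \<partial>lborel) \<partial>lborel)"
    by (simp add: nn_integral_cmult nn_integral_lborel_translate)
  also have "\<dots> = (\<integral>\<^sup>+y. (\<integral>\<^sup>+x. f (T x) * g (T x + y) \<partial>lborel) \<partial>lborel)"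
    by (rule lborel_pair.Fubini'[symmetric]) measurable
  \<comment> \<open>With \<open>T z = y\<close>, shifting \<open>x\<close> by \<open>- z\<close>
    moves the displacement \<open>y\<close> from the argument of \<open>g\<close> to that of
    \<open>f\<close>.\<close>
  also have "\<dots> = (\<integral>\<^sup>+y. (\<integral>\<^sup>+x. f (T x - y) * g (T x) \<partial>lborel) \<partial>lborel)"
  proof (rule nn_integral_cong)
    fix y
    obtain z where z: "T z = y" using surj by (metis surjD)
    show "(\<integral>\<^sup>+x. f (T x) * g (T x + y) \<partial>lborel) = (\<integral>\<^sup>+x. f (T x - y) * g (T x) \<partial>lborel)"
      by (subst nn_integral_lborel_translate[of _ "- z", symmetric])
        (auto simp: linear_add[OF T] linear_neg[OF T] z linear_diff[OF T])
  qed
  also have "\<dots> = (\<integral>\<^sup>+x. (\<integral>\<^sup>+y. f (T x - y) * g (T x) \<partial>lborel) \<partial>lborel)"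
    by (rule lborel_pair.Fubini') measurable
  also have "\<dots> = (\<integral>\<^sup>+x. f x \<partial>lborel) * ?c"
    by (simp add: nn_integral_multc nn_integral_cmult nn_integral_lborel_reflect gT)
  finally have eq: "(\<integral>\<^sup>+x. f (T x) \<partial>lborel) * ?c = (\<integral>\<^sup>+x. f x \<partial>lborel) * ?c" .
  \<comment> \<open>The unit ball has positive and finite volume, so \<open>?c\<close> can be
    cancelled.\<close>
  have "?c \<noteq> 0" unfolding c
    by (metis content_ball_pos emeasure_eq_measure2 measure_def enn2real_0 less_irrefl zero_less_one)
  moreover have "?c < \<infinity>" unfolding c by (rule emeasure_lborel_ball_finite)
  ultimately show ?thesis using eq
    by (auto simp: ennreal_mult_cancel_left mult.commute[of _ ?c])
qed

section \<open>Real coordinates and the Gaussian density of a complex matrix\<close>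

lemma Basis_complex_matrix:
  "bij_betw (\<lambda>(i, j, b). axis i (axis j (if b then \<i> else 1))) UNIV (Basis :: (complex^'n^'m) set)"
proof (rule bij_betw_imageI)
  show "inj (\<lambda>(i, j, b). axis i (axis j (if b then \<i> else 1)) :: complex^'n^'m)"
    by (auto simp: inj_on_def axis_eq_axis split: if_splits)
  show "range (\<lambda>(i, j, b). axis i (axis j (if b then \<i> else 1))) = (Basis :: (complex^'n^'m) set)"
    by (force simp: Basis_vec_def Basis_complex_def image_iff split: if_splits)
qed

lemma borel_measurable_vec:
  fixes f :: "'a \<Rightarrow> 'b::euclidean_space^'n"
  assumes "\<And>i. (\<lambda>x. f x $ i) \<in> borel_measurable M"
  shows "f \<in> borel_measurable M"
proof (rule borel_measurable_euclidean_space[THEN iffD2], rule ballI)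
  fix b :: "'b^'n" assume "b \<in> Basis"
  then obtain i u where "b = axis i u" by (auto simp: Basis_vec_def)
  then show "(\<lambda>x. f x \<bullet> b) \<in> borel_measurable M"
    using assms by (auto simp: inner_axis)
qed

lemma vec_nth_measurable [measurable]:
  "(\<lambda>v :: 'b::euclidean_space^'n. v $ i) \<in> borel_measurable borel"
  by (intro borel_measurable_continuous_onI continuous_intros)

lemma cnj_measurable [measurable]: "cnj \<in> borel_measurable borel"
  by (intro borel_measurable_continuous_onI continuous_intros)

definition matrix_of_reals :: "('n \<times> 'n \<times> bool \<Rightarrow> real) \<Rightarrow> complex^'n^'n" where
  "matrix_of_reals g = (\<chi> i j. Complex (g (i, j, False)) (g (i, j, True)))"

lemma matrix_of_reals_nth:
  "matrix_of_reals g $ i $ j = of_real (g (i, j, False)) + \<i> * of_real (g (i, j, True))"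
  by (simp add: matrix_of_reals_def complex_eq_iff)

abbreviation iid_normal :: "('i \<Rightarrow> real) measure" where
  "iid_normal \<equiv> (\<Pi>\<^sub>M p\<in>UNIV. std_normal)"

lemma matrix_of_reals_measurable [measurable]:
  assumes "sets M = sets borel"
  shows "(matrix_of_reals :: ('n::finite \<times> 'n \<times> bool \<Rightarrow> real) \<Rightarrow> _) \<in> (\<Pi>\<^sub>M p\<in>UNIV. M) \<rightarrow>\<^sub>M borel"
proof (intro borel_measurable_vec)
  have "(\<lambda>g. g p) \<in> (\<Pi>\<^sub>M p\<in>UNIV. M) \<rightarrow>\<^sub>M borel" for p :: "'n::finite \<times> 'n \<times> bool"
    using measurable_component_singleton[of p UNIV "\<lambda>_. M"] measurable_cong_sets[OF refl assms] by blast
  then show "(\<lambda>g. matrix_of_reals g $ i $ j) \<in> borel_measurable (\<Pi>\<^sub>M p\<in>UNIV. M)" for i j :: "'n::finite"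
    unfolding matrix_of_reals_nth by measurable
qed

lemma inner_matrix_of_reals:
  "matrix_of_reals g \<bullet> axis i (axis j (if b then \<i> else 1)) = g (i, j, b)"
  by (simp add: inner_axis matrix_of_reals_def inner_complex_def)

lemma norm_matrix_of_reals: "(norm (matrix_of_reals g))\<^sup>2 = (\<Sum>p\<in>UNIV. (g p)\<^sup>2)"
proof -
  have "(norm (matrix_of_reals g))\<^sup>2 = (\<Sum>b\<in>Basis. (matrix_of_reals g \<bullet> b)\<^sup>2)"
    unfolding power2_norm_eq_inner by (subst euclidean_inner) (simp add: power2_eq_square)
  also have "\<dots> = (\<Sum>p\<in>UNIV. (g p)\<^sup>2)"
    by (subst sum.reindex_bij_betw[OF Basis_complex_matrix, symmetric])
      (auto intro!: sum.cong simp: inner_matrix_of_reals)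
  finally show ?thesis .
qed

text \<open>Boxes pull back to products of intervals, and Lebesgue measure is determined by its
  values on boxes.\<close>

lemma distr_matrix_of_reals:
  "distr (\<Pi>\<^sub>M p\<in>UNIV. lborel) borel matrix_of_reals = (lborel :: (complex^'n^'n) measure)"
proof (rule lborel_eqI[symmetric])
  interpret product_sigma_finite "\<lambda>p :: 'n \<times> 'n \<times> bool. lborel :: real measure" by standard
  fix l u :: "complex^'n^'n"
  assume le: "\<And>b. b \<in> Basis \<Longrightarrow> l \<bullet> b \<le> u \<bullet> b"
  define e :: "'n \<times> 'n \<times> bool \<Rightarrow> complex^'n^'n" where "e = (\<lambda>(i, j, b). axis i (axis j (if b then \<i> else 1)))"
  have e: "bij_betw e UNIV Basis" using Basis_complex_matrix by (simp add: e_def)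
  have inner: "matrix_of_reals g \<bullet> e p = g p" for g p
    by (cases p) (simp add: e_def inner_matrix_of_reals)
  have Basis: "Basis = range e" using e by (simp add: bij_betw_def)
  have "matrix_of_reals -` box l u \<inter> space (\<Pi>\<^sub>M p\<in>UNIV. lborel) = (\<Pi>\<^sub>E p\<in>UNIV. {l \<bullet> e p <..< u \<bullet> e p})"
    by (auto simp: box_def Basis inner space_PiM)
  then have "emeasure (distr (\<Pi>\<^sub>M p\<in>UNIV. lborel) borel matrix_of_reals) (box l u) =
    (\<Prod>p\<in>UNIV. emeasure lborel {l \<bullet> e p <..< u \<bullet> e p})"
    by (simp add: emeasure_distr emeasure_PiM)
  also have "\<dots> = (\<Prod>p\<in>UNIV. ennreal ((u - l) \<bullet> e p))"
    using le by (intro prod.cong) (auto simp: Basis inner_diff_left)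
  also have "\<dots> = (\<Prod>b\<in>Basis. ennreal ((u - l) \<bullet> b))"
    by (rule prod.reindex_bij_betw[OF e])
  also have "\<dots> = ennreal (\<Prod>b\<in>Basis. (u - l) \<bullet> b)"
    using le by (intro prod_ennreal) (auto simp: inner_diff_left)
  finally show "emeasure (distr (\<Pi>\<^sub>M p\<in>UNIV. lborel) borel matrix_of_reals) (box l u) = ennreal (\<Prod>b\<in>Basis. (u - l) \<bullet> b)" .
qed simp

lemma iid_normal_density:
  "(iid_normal :: ('i::finite \<Rightarrow> real) measure) =
    density (\<Pi>\<^sub>M p\<in>UNIV. lborel) (\<lambda>g. \<Prod>p\<in>UNIV. ennreal (std_normal_density (g p)))"
proof -
  interpret N: product_prob_space "\<lambda>p :: 'i. std_normal" UNIV
    by (intro product_prob_spaceI prob_space_std_normal)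
  interpret L: product_sigma_finite "\<lambda>p :: 'i. lborel :: real measure" by standard
  show ?thesis
  proof (rule N.PiM_eqI[symmetric])
    show "sets (density (\<Pi>\<^sub>M p\<in>UNIV. lborel) (\<lambda>g. \<Prod>p\<in>UNIV. ennreal (std_normal_density (g p)))) = sets (iid_normal :: ('i \<Rightarrow> real) measure)"
      by (auto intro!: sets_PiM_cong)
    fix A :: "'i \<Rightarrow> real set"
    assume A: "\<And>i. i \<in> UNIV \<Longrightarrow> A i \<in> sets std_normal"
    then have [measurable]: "A i \<in> sets borel" for i by simp
    have "Pi\<^sub>E UNIV A \<in> sets (\<Pi>\<^sub>M p\<in>UNIV. lborel :: real measure)"
      by (rule sets_PiM_I_finite) auto
    then have "emeasure (density (\<Pi>\<^sub>M p\<in>UNIV. lborel) (\<lambda>g. \<Prod>p\<in>UNIV. ennreal (std_normal_density (g p)))) (Pi\<^sub>E UNIV A) =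
      (\<integral>\<^sup>+g. (\<Prod>p\<in>UNIV. ennreal (std_normal_density (g p))) * indicator (Pi\<^sub>E UNIV A) g \<partial>(\<Pi>\<^sub>M p\<in>UNIV. lborel))"
      by (subst emeasure_density) auto
    also have "\<dots> = (\<integral>\<^sup>+g. (\<Prod>p\<in>UNIV. ennreal (std_normal_density (g p)) * indicator (A p) (g p)) \<partial>(\<Pi>\<^sub>M p\<in>UNIV. lborel))"
    proof (rule nn_integral_cong)
      fix g :: "'i \<Rightarrow> real"
      have "indicator (Pi\<^sub>E UNIV A) g = (\<Prod>p\<in>UNIV. indicator (A p) (g p) :: ennreal)"
        by (auto simp: indicator_def prod_eq_1_iff PiE_iff split: if_splits)
      then show "(\<Prod>p\<in>UNIV. ennreal (std_normal_density (g p))) * indicator (Pi\<^sub>E UNIV A) g =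
        (\<Prod>p\<in>UNIV. ennreal (std_normal_density (g p)) * indicator (A p) (g p))"
        by (simp add: prod.distrib)
    qed
    also have "\<dots> = (\<Prod>p\<in>UNIV. \<integral>\<^sup>+x. ennreal (std_normal_density x) * indicator (A p) x \<partial>lborel)"
      by (rule L.product_nn_integral_prod) auto
    also have "\<dots> = (\<Prod>p\<in>UNIV. emeasure std_normal (A p))"
      by (intro prod.cong) (auto simp: emeasure_density)
    finally show "emeasure (density (\<Pi>\<^sub>M p\<in>UNIV. lborel) (\<lambda>g. \<Prod>p\<in>UNIV. ennreal (std_normal_density (g p)))) (Pi\<^sub>E UNIV A) =
      (\<Prod>p\<in>UNIV. emeasure std_normal (A p))" .
  qed simp
qed

text \<open>The product of the coordinate densities depends on the matrix only through its norm;
  invariance under linear isometries rests on this.\<close>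

lemma nn_integral_matrix_of_reals:
  fixes f :: "complex^'n^'n \<Rightarrow> ennreal"
  assumes [measurable]: "f \<in> borel_measurable borel"
  shows "(\<integral>\<^sup>+g. f (matrix_of_reals g) \<partial>iid_normal) =
    (\<integral>\<^sup>+G. ennreal ((1 / sqrt (2 * pi)) ^ CARD('n \<times> 'n \<times> bool) * exp (- (norm G)\<^sup>2 / 2)) * f G \<partial>lborel)"
proof -
  let ?K = "(1 / sqrt (2 * pi)) ^ CARD('n \<times> 'n \<times> bool)"
  have "(\<integral>\<^sup>+g. f (matrix_of_reals g) \<partial>iid_normal) =
    (\<integral>\<^sup>+g. (\<Prod>p\<in>UNIV. ennreal (std_normal_density (g p))) * f (matrix_of_reals g) \<partial>(\<Pi>\<^sub>M p\<in>UNIV. lborel))"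
    unfolding iid_normal_density by (subst nn_integral_density) auto
  also have "\<dots> = (\<integral>\<^sup>+g. ennreal (?K * exp (- (norm (matrix_of_reals g))\<^sup>2 / 2)) * f (matrix_of_reals g) \<partial>(\<Pi>\<^sub>M p\<in>UNIV. lborel))"
  proof (intro nn_integral_cong arg_cong2[where f="(*)"] refl)
    fix g :: "'n \<times> 'n \<times> bool \<Rightarrow> real"
    have "(\<Prod>p\<in>UNIV. std_normal_density (g p)) = ?K * (\<Prod>p\<in>UNIV. exp (- (g p)\<^sup>2 / 2))"
      unfolding std_normal_density_def prod.distrib prod_constant ..
    also have "(\<Prod>p\<in>UNIV. exp (- (g p)\<^sup>2 / 2)) = exp (- (norm (matrix_of_reals g))\<^sup>2 / 2)"
      unfolding norm_matrix_of_reals by (simp add: exp_sum[symmetric] sum_negf sum_divide_distrib)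
    finally show "(\<Prod>p\<in>UNIV. ennreal (std_normal_density (g p))) = ennreal (?K * exp (- (norm (matrix_of_reals g))\<^sup>2 / 2))"
      by (simp add: prod_ennreal)
  qed
  also have "\<dots> = (\<integral>\<^sup>+G. ennreal (?K * exp (- (norm G)\<^sup>2 / 2)) * f G \<partial>distr (\<Pi>\<^sub>M p\<in>UNIV. lborel) borel matrix_of_reals)"
    by (subst nn_integral_distr) auto
  finally show ?thesis unfolding distr_matrix_of_reals .
qed

section \<open>Unitary invariance of the ensemble\<close>

text \<open>In the trace form, unitary factors cancel and norm preservation becomes algebra.\<close>

lemma norm_matrix_eq_trace: "(norm (A :: complex^'n^'n))\<^sup>2 = Re (trace (conj_transpose A ** A))"
proof -
  have "trace (conj_transpose A ** A) = (\<Sum>j\<in>UNIV. \<Sum>i\<in>UNIV. of_real ((cmod (A $ i $ j))\<^sup>2))"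
    by (simp only: trace_def matrix_matrix_mult_def vec_lambda_beta conj_transpose_nth complex_norm_square mult.commute)
  then have "Re (trace (conj_transpose A ** A)) = (\<Sum>i\<in>UNIV. \<Sum>j\<in>UNIV. (cmod (A $ i $ j))\<^sup>2)"
    by (subst sum.swap) simp
  also have "\<dots> = (norm A)\<^sup>2"
    by (simp add: norm_vec_def L2_set_def sum_nonneg)
  finally show ?thesis ..
qed

lemma norm_conj_transpose: "norm (conj_transpose A) = norm (A :: complex^'n^'n)"
proof -
  have "(norm (conj_transpose A))\<^sup>2 = (norm A)\<^sup>2"
    using trace_mul_sym[of A "conj_transpose A"] unfolding norm_matrix_eq_trace by simp
  then show ?thesis by simp
qed

lemma norm_unitary_mult:
  assumes "unitary U"
  shows "norm (U ** A) = norm (A :: complex^'n^'n)"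
proof -
  have "conj_transpose (U ** A) ** (U ** A) = conj_transpose A ** (conj_transpose U ** U) ** A"
    by (simp add: conj_transpose_mult matrix_mul_assoc)
  then have "(norm (U ** A))\<^sup>2 = (norm A)\<^sup>2"
    using assms unfolding norm_matrix_eq_trace by (simp add: unitary_def)
  then show ?thesis by simp
qed

lemma norm_unitary_conj:
  assumes "unitary U"
  shows "norm (U ** A ** conj_transpose U) = norm (A :: complex^'n^'n)"
proof -
  have "norm (U ** A ** conj_transpose U) = norm (U ** conj_transpose (U ** A))"
    by (subst norm_conj_transpose[symmetric]) (simp add: conj_transpose_mult matrix_mul_assoc)
  then show ?thesis using assms by (simp add: norm_unitary_mult norm_conj_transpose)
qed

definition gue_matrix :: "('n \<times> 'n \<times> bool \<Rightarrow> real) \<Rightarrow> complex^'n^'n" where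
  "gue_matrix g = (1/2) *\<^sub>R (matrix_of_reals g + conj_transpose (matrix_of_reals g))"

lemma conj_transpose_measurable [measurable]:
  "conj_transpose \<in> borel_measurable (borel :: (complex^'n^'n) measure)"
  by (intro borel_measurable_vec) simp

lemma gue_matrix_measurable [measurable]: "gue_matrix \<in> iid_normal \<rightarrow>\<^sub>M borel"
proof -
  have [measurable]: "matrix_of_reals \<in> iid_normal \<rightarrow>\<^sub>M borel" by (rule matrix_of_reals_measurable) simp
  show ?thesis unfolding gue_matrix_def by measurable
qed

text \<open>All randomness is expressed through one independent family of real coordinates, where
  independence of matrix blocks can be read off from index sets.\<close>

lemma gue_eq: "gue = distr iid_normal borel gue_matrix"
proof -
  have [measurable]: "matrix_of_reals \<in> iid_normal \<rightarrow>\<^sub>M borel" by (rule matrix_of_reals_measurable) simp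
  show ?thesis
    unfolding gue_def complex_gaussian_matrix_def matrix_of_reals_def[symmetric]
    by (subst distr_distr) (auto simp: gue_matrix_def[abs_def] comp_def)
qed

lemma conj_transpose_gue_matrix [simp]: "conj_transpose (gue_matrix g) = gue_matrix g"
  by (simp add: gue_matrix_def conj_transpose_scaleR conj_transpose_add add.commute)

text \<open>Conjugation by \<open>U\<close> is a linear isometry of matrix space, so it preserves
  Lebesgue measure and the Gaussian density, and it commutes with taking the hermitian part.\<close>

lemma nn_integral_gue_unitary:
  fixes f :: "complex^'n^'n \<Rightarrow> ennreal"
  assumes f [measurable]: "f \<in> borel_measurable borel" and U: "unitary U"
  shows "(\<integral>\<^sup>+g. f (U ** gue_matrix g ** conj_transpose U) \<partial>iid_normal) = (\<integral>\<^sup>+g. f (gue_matrix g) \<partial>iid_normal)"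
proof -
  define h where "h G = f ((1/2) *\<^sub>R (G + conj_transpose G))" for G
  have [measurable]: "h \<in> borel_measurable borel" unfolding h_def by measurable
  define T where "T G = U ** G ** conj_transpose U" for G
  have T: "linear T"
  proof (rule linearI)
    show "T (A + B) = T A + T B" for A B
      by (simp add: T_def matrix_add_ldistrib matrix_mult_distrib_right)
    show "T (c *\<^sub>R A) = c *\<^sub>R T A" for c A
      by (simp add: T_def vec_eq_iff matrix_matrix_mult_def flip: scaleR_sum_right)
  qed
  have norm: "norm (T G) = norm G" for G
    using U by (simp add: T_def norm_unitary_conj)
  have [measurable]: "T \<in> borel_measurable borel"
    using T by (intro borel_measurable_continuous_onI linear_continuous_on linear_conv_bounded_linear[THEN iffD1])
  have hT: "f (U ** gue_matrix g ** conj_transpose U) = h (T (matrix_of_reals g))" for g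
  proof -
    have "T (c *\<^sub>R A) = c *\<^sub>R T A" "T (A + B) = T A + T B" "conj_transpose (T A) = T (conj_transpose A)" for c A B
      using linear_scale[OF T] linear_add[OF T] by (simp_all add: T_def conj_transpose_mult matrix_mul_assoc)
    then show ?thesis by (simp add: h_def gue_matrix_def T_def[symmetric])
  qed
  let ?k = "\<lambda>G :: complex^'n^'n. ennreal ((1 / sqrt (2 * pi)) ^ CARD('n \<times> 'n \<times> bool) * exp (- (norm G)\<^sup>2 / 2))"
  have "(\<integral>\<^sup>+g. f (U ** gue_matrix g ** conj_transpose U) \<partial>iid_normal) = (\<integral>\<^sup>+G. ?k (T G) * h (T G) \<partial>lborel)"
    unfolding hT norm using nn_integral_matrix_of_reals[of "\<lambda>G. h (T G)"] by simp
  also have "\<dots> = (\<integral>\<^sup>+G. ?k G * h G \<partial>lborel)"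
    by (rule nn_integral_lborel_isometry[OF T norm]) measurable
  also have "\<dots> = (\<integral>\<^sup>+g. f (gue_matrix g) \<partial>iid_normal)"
    using nn_integral_matrix_of_reals[of h] by (simp add: h_def gue_matrix_def)
  finally show ?thesis .
qed

section \<open>Independent coordinate blocks and the length of a column\<close>

lemma prob_space_iid_normal: "prob_space (iid_normal :: ('i \<Rightarrow> real) measure)"
  by (intro prob_space_PiM prob_space_std_normal)

lemma nn_integral_iid_normal_component:
  fixes p :: "'i::finite"
  assumes [measurable]: "F \<in> borel_measurable borel"
  shows "(\<integral>\<^sup>+g. F (g p) \<partial>iid_normal) = (\<integral>\<^sup>+x. F x \<partial>std_normal)"
proof -
  have "(\<integral>\<^sup>+x. F x \<partial>std_normal) = (\<integral>\<^sup>+x. F x \<partial>distr iid_normal std_normal (\<lambda>g. g p))"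
    by (subst distr_PiM_component) (auto intro: prob_space_std_normal)
  also have "\<dots> = (\<integral>\<^sup>+g. F (g p) \<partial>iid_normal)"
    by (rule nn_integral_distr) simp_all
  finally show ?thesis ..
qed

text \<open>Since \<open>H g x\<close> reads \<open>g\<close> only inside \<open>I\<close> and
  \<open>x\<close> only outside \<open>I\<close>, its two arguments may come from one family or from
  two independent copies. The later independence arguments for the matrix all use this form.\<close>

lemma nn_integral_iid_normal_decouple:
  fixes H :: "('i::finite \<Rightarrow> real) \<Rightarrow> ('i \<Rightarrow> real) \<Rightarrow> ennreal"
  assumes H [measurable]: "case_prod H \<in> borel_measurable (iid_normal \<Otimes>\<^sub>M iid_normal)"
    and dep: "\<And>g g' x y. (\<And>p. p \<in> I \<Longrightarrow> g p = g' p) \<Longrightarrow> (\<And>p. p \<notin> I \<Longrightarrow> x p = y p) \<Longrightarrow> H g x = H g' y"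
  shows "(\<integral>\<^sup>+g. H g g \<partial>iid_normal) = (\<integral>\<^sup>+x. (\<integral>\<^sup>+g. H g x \<partial>iid_normal) \<partial>iid_normal)"
proof -
  define N where "N J = (\<Pi>\<^sub>M p\<in>J. std_normal)" for J :: "'i set"
  interpret N: product_prob_space "\<lambda>p :: 'i. std_normal" UNIV
    by (intro product_prob_spaceI prob_space_std_normal)
  have prob: "prob_space (N J)" for J
    unfolding N_def by (intro prob_space_PiM prob_space_std_normal)
  interpret P: prob_space "N J" for J by (rule prob)
  interpret PP: pair_sigma_finite "N J" "N K" for J K by standard
  have merge [measurable]: "merge I (- I) \<in> N I \<Otimes>\<^sub>M N (- I) \<rightarrow>\<^sub>M N UNIV"
    unfolding N_def using measurable_merge[of I "- I" "\<lambda>_. std_normal"] by simp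
  have H' [measurable]: "case_prod H \<in> borel_measurable (N UNIV \<Otimes>\<^sub>M N UNIV)"
    unfolding N_def by simp
  have fold: "(\<integral>\<^sup>+g. f g \<partial>N UNIV) = (\<integral>\<^sup>+x. (\<integral>\<^sup>+y. f (merge I (- I) (x, y)) \<partial>N (- I)) \<partial>N I)"
    if "f \<in> borel_measurable (N UNIV)" for f
    using that N.product_nn_integral_fold[of I "- I" f] by (simp add: N_def)
  \<comment> \<open>\<open>K\<close> views \<open>H\<close> as a function of the coordinates inside
    and outside \<open>I\<close>. By \<open>dep\<close>, the remaining halves of the two copies do
    not enter and integrate to 1.\<close>
  define K where "K x y = H (merge I (- I) (x, y)) (merge I (- I) (x, y))" for x y
  have K [measurable]: "case_prod K \<in> borel_measurable (N I \<Otimes>\<^sub>M N (- I))"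
    unfolding K_def by measurable
  have KH: "H (merge I (- I) (x, y)) (merge I (- I) (x', y')) = K x y'" for x y x' y'
    unfolding K_def by (rule dep) (auto simp: merge_def)
  have one: "(\<integral>\<^sup>+x. c \<partial>N J) = c" for c J
    by (simp add: P.emeasure_space_1)
  have "(\<integral>\<^sup>+x. (\<integral>\<^sup>+g. H g x \<partial>N UNIV) \<partial>N UNIV) =
    (\<integral>\<^sup>+x'. (\<integral>\<^sup>+y'. (\<integral>\<^sup>+x. (\<integral>\<^sup>+y. H (merge I (- I) (x, y)) (merge I (- I) (x', y')) \<partial>N (- I)) \<partial>N I) \<partial>N (- I)) \<partial>N I)"
  proof -
    have "(\<integral>\<^sup>+g. H g x \<partial>N UNIV) = (\<integral>\<^sup>+x'. (\<integral>\<^sup>+y'. H (merge I (- I) (x', y')) x \<partial>N (- I)) \<partial>N I)"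
      if "x \<in> space (N UNIV)" for x
      using that by (intro fold) measurable
    moreover have "merge I (- I) (x', y') \<in> space (N UNIV)" for x' y'
      by (simp add: N_def space_PiM)
    ultimately show ?thesis
      by (subst fold) (simp_all, measurable)
  qed
  also have "\<dots> = (\<integral>\<^sup>+y'. (\<integral>\<^sup>+x. K x y' \<partial>N I) \<partial>N (- I))"
    unfolding KH one ..
  also have "\<dots> = (\<integral>\<^sup>+x. (\<integral>\<^sup>+y'. K x y' \<partial>N (- I)) \<partial>N I)"
    by (rule PP.Fubini') measurable
  also have "\<dots> = (\<integral>\<^sup>+g. H g g \<partial>N UNIV)"
    unfolding K_def by (rule fold[symmetric]) measurable
  finally show ?thesis by (simp add: N_def)
qed

text \<open>The sign +1 serves real parts of matrix entries and -1 imaginary parts, because adding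
  the conjugate transpose adds the former and subtracts the latter.\<close>

lemma nn_integral_iid_normal_pair:
  fixes p q :: "'i::finite" and e :: real
  assumes [measurable]: "F \<in> borel_measurable borel" and pq: "p \<noteq> q" and e: "e = 1 \<or> e = -1"
  shows "(\<integral>\<^sup>+g. F \<bar>(g p + e * g q) / sqrt 2\<bar> \<partial>iid_normal) = (\<integral>\<^sup>+x. F x \<partial>chi_measure 1)"
proof -
  interpret N: prob_space std_normal by (rule prob_space_std_normal)
  let ?c = "1 / sqrt 2"
  have "(\<integral>\<^sup>+g. F \<bar>(g p + e * g q) / sqrt 2\<bar> \<partial>iid_normal) =
    (\<integral>\<^sup>+x. (\<integral>\<^sup>+g. F \<bar>(g p + e * x q) / sqrt 2\<bar> \<partial>iid_normal) \<partial>iid_normal)"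
    using pq by (intro nn_integral_iid_normal_decouple[where I="{p}" and H="\<lambda>g x. F \<bar>(g p + e * x q) / sqrt 2\<bar>"]) auto
  also have "\<dots> = (\<integral>\<^sup>+y. (\<integral>\<^sup>+x. F \<bar>(x + e * y) / sqrt 2\<bar> \<partial>std_normal) \<partial>std_normal)"
  proof -
    have "(\<integral>\<^sup>+g. F \<bar>(g p + e * y) / sqrt 2\<bar> \<partial>iid_normal) = (\<integral>\<^sup>+x. F \<bar>(x + e * y) / sqrt 2\<bar> \<partial>std_normal)" for y
      by (rule nn_integral_iid_normal_component[of "\<lambda>x. F \<bar>(x + e * y) / sqrt 2\<bar>"]) measurable
    then show ?thesis
      by (simp only:) (rule nn_integral_iid_normal_component[of "\<lambda>y. \<integral>\<^sup>+x. F \<bar>(x + e * y) / sqrt 2\<bar> \<partial>std_normal"], measurable)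
  qed
  also have "\<dots> = (\<integral>\<^sup>+y. (\<integral>\<^sup>+x. F \<bar>(x + y) / sqrt 2\<bar> \<partial>std_normal) \<partial>std_normal)"
    using e nn_integral_std_normal_uminus[of "\<lambda>y. \<integral>\<^sup>+x. F \<bar>(x + y) / sqrt 2\<bar> \<partial>std_normal"]
    by auto
  also have "\<dots> = (\<integral>\<^sup>+y. (\<integral>\<^sup>+x. F \<bar>?c * y + ?c * x\<bar> \<partial>std_normal) \<partial>std_normal)"
    by (simp add: add_divide_distrib add.commute)
  also have "\<dots> = (\<integral>\<^sup>+u. F \<bar>sqrt (?c\<^sup>2 + ?c\<^sup>2) * u\<bar> \<partial>std_normal)"
    by (rule nn_integral_std_normal_add) auto
  also have "\<dots> = (\<integral>\<^sup>+u. F \<bar>u\<bar> \<partial>std_normal)"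
    by (simp add: power_divide)
  also have "\<dots> = (\<integral>\<^sup>+x. F x \<partial>chi_measure 1)"
    by (rule nn_integral_std_normal_abs) simp
  finally show ?thesis .
qed

text \<open>Injectivity and disjointness of the index maps let the summands read separate
  coordinates. Each induction step decouples one square and adds it by
  \<open>chi_add_squares\<close>.\<close>

lemma nn_integral_iid_normal_sum_squares:
  fixes p q :: "'c \<Rightarrow> 'i::finite" and e :: "'c \<Rightarrow> real"
  assumes F: "F \<in> borel_measurable borel"
    and A: "finite A" "A \<noteq> {}"
    and inj: "inj_on p A" "inj_on q A" "\<And>a b. a \<in> A \<Longrightarrow> b \<in> A \<Longrightarrow> p a \<noteq> q b"
    and e: "\<And>a. e a = 1 \<or> e a = -1"
  shows "(\<integral>\<^sup>+g. F (sqrt (\<Sum>a\<in>A. ((g (p a) + e a * g (q a)) / sqrt 2)\<^sup>2)) \<partial>iid_normal) =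
    (\<integral>\<^sup>+z. F z \<partial>chi_measure (card A))"
  using A inj F
proof (induction A arbitrary: F rule: finite_ne_induct)
  case (singleton a)
  then show ?case
    using nn_integral_iid_normal_pair[of F "p a" "q a" "e a"] e by simp
next
  case (insert a A)
  note [measurable] = \<open>F \<in> borel_measurable borel\<close>
  let ?X = "\<lambda>g a. (g (p a) + e a * g (q a)) / sqrt 2"
  have "p b \<noteq> p a" "q b \<noteq> p a" "p b \<noteq> q a" "q b \<noteq> q a" "b \<noteq> a" if "b \<in> A" for b
    using that insert by (auto simp: inj_on_def) (metis insertCI)+
  then have dep: "(\<Sum>b\<in>A. (?X g b)\<^sup>2) = (\<Sum>b\<in>A. (?X g' b)\<^sup>2)"
    if "\<And>r. r \<notin> {p a, q a} \<Longrightarrow> g r = g' r" for g g' :: "'i \<Rightarrow> real"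
    using that by (intro sum.cong) auto
  have "(\<integral>\<^sup>+g. F (sqrt (\<Sum>b\<in>insert a A. (?X g b)\<^sup>2)) \<partial>iid_normal) =
    (\<integral>\<^sup>+g. F (sqrt ((?X g a)\<^sup>2 + (\<Sum>b\<in>A. (?X g b)\<^sup>2))) \<partial>iid_normal)"
    using insert by simp
  also have "\<dots> = (\<integral>\<^sup>+x. (\<integral>\<^sup>+g. F (sqrt ((?X g a)\<^sup>2 + (\<Sum>b\<in>A. (?X x b)\<^sup>2))) \<partial>iid_normal) \<partial>iid_normal)"
  proof (rule nn_integral_iid_normal_decouple[where I="{p a, q a}" and H="\<lambda>g x. F (sqrt ((?X g a)\<^sup>2 + (\<Sum>b\<in>A. (?X x b)\<^sup>2)))"])
    fix g g' x y :: "'i \<Rightarrow> real"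
    assume "\<And>r. r \<in> {p a, q a} \<Longrightarrow> g r = g' r" "\<And>r. r \<notin> {p a, q a} \<Longrightarrow> x r = y r"
    then show "F (sqrt ((?X g a)\<^sup>2 + (\<Sum>b\<in>A. (?X x b)\<^sup>2))) = F (sqrt ((?X g' a)\<^sup>2 + (\<Sum>b\<in>A. (?X y b)\<^sup>2)))"
      using dep[of x y] by simp
  qed measurable
  also have "\<dots> = (\<integral>\<^sup>+x. (\<integral>\<^sup>+u. F (sqrt (u\<^sup>2 + (sqrt (\<Sum>b\<in>A. (?X x b)\<^sup>2))\<^sup>2)) \<partial>chi_measure 1) \<partial>iid_normal)"
  proof (rule nn_integral_cong)
    fix x :: "'i \<Rightarrow> real"
    have "p a \<noteq> q a" using insert by auto
    then show "(\<integral>\<^sup>+g. F (sqrt ((?X g a)\<^sup>2 + (\<Sum>b\<in>A. (?X x b)\<^sup>2))) \<partial>iid_normal) =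
      (\<integral>\<^sup>+u. F (sqrt (u\<^sup>2 + (sqrt (\<Sum>b\<in>A. (?X x b)\<^sup>2))\<^sup>2)) \<partial>chi_measure 1)"
      using nn_integral_iid_normal_pair[of "\<lambda>u. F (sqrt (u\<^sup>2 + (\<Sum>b\<in>A. (?X x b)\<^sup>2)))" "p a" "q a" "e a"] e
      by (simp add: sum_nonneg power_divide)
  qed
  also have "\<dots> = (\<integral>\<^sup>+b. (\<integral>\<^sup>+u. F (sqrt (u\<^sup>2 + b\<^sup>2)) \<partial>chi_measure 1) \<partial>chi_measure (card A))"
  proof -
    interpret C: prob_space "chi_measure 1" by (rule prob_space_chi_measure)
    have "(\<lambda>b. \<integral>\<^sup>+u. F (sqrt (u\<^sup>2 + b\<^sup>2)) \<partial>chi_measure 1) \<in> borel_measurable borel"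
      by measurable
    then show ?thesis using insert by (intro insert.IH) auto
  qed
  also have "\<dots> = (\<integral>\<^sup>+u. (\<integral>\<^sup>+b. F (sqrt (u\<^sup>2 + b\<^sup>2)) \<partial>chi_measure (card A)) \<partial>chi_measure 1)"
  proof -
    interpret pair_sigma_finite "chi_measure 1" "chi_measure (card A)"
      by (intro pair_sigma_finite.intro sigma_finite_chi_measure)
    show ?thesis by (rule Fubini') measurable
  qed
  also have "\<dots> = (\<integral>\<^sup>+z. F z \<partial>chi_measure (Suc (card A)))"
    using insert by (intro chi_add_squares) (auto simp: Suc_le_eq card_gt_0_iff)
  finally show ?case using insert by simp
qed

definition gue_column :: "'n set \<Rightarrow> 'n \<Rightarrow> ('n \<times> 'n \<times> bool \<Rightarrow> real) \<Rightarrow> complex^'n" where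
  "gue_column S k g = (\<chi> i. if i \<in> S then gue_matrix g $ i $ k else 0)"

lemma gue_matrix_nth:
  "gue_matrix g $ i $ j = Complex ((g (i, j, False) + g (j, i, False)) / 2) ((g (i, j, True) - g (j, i, True)) / 2)"
  by (simp add: gue_matrix_def matrix_of_reals_def complex_eq_iff)

lemma gue_matrix_diag: "gue_matrix g $ i $ i = of_real (g (i, i, False))"
  by (simp add: gue_matrix_nth complex_eq_iff)

text \<open>Real and imaginary parts of the entries are normalised pairs, as in
  \<open>nn_integral_iid_normal_pair\<close>, divided by sqrt 2. This yields
  \<open>2 * card S\<close> independent squares and the factor 1 / 2.\<close>

lemma nn_integral_gue_column:
  fixes S :: "'n::finite set"
  assumes [measurable]: "F \<in> borel_measurable borel" and S: "S \<noteq> {}" "k \<notin> S"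
  shows "(\<integral>\<^sup>+g. F ((norm (gue_column S k g))\<^sup>2) \<partial>iid_normal) = (\<integral>\<^sup>+z. F (z\<^sup>2 / 2) \<partial>chi_measure (2 * card S))"
proof -
  let ?p = "\<lambda>(i, b). (i, k, b)" and ?q = "\<lambda>(i, b). (k, i, b)"
  let ?e = "\<lambda>(i :: 'n, b). if b then - 1 else 1 :: real"
  let ?X = "\<lambda>g a. (g (?p a) + ?e a * g (?q a)) / sqrt 2"
  have eq: "(norm (gue_column S k g))\<^sup>2 = (sqrt (\<Sum>a\<in>S \<times> UNIV. (?X g a)\<^sup>2))\<^sup>2 / 2" for g
  proof -
    have "(norm (gue_column S k g))\<^sup>2 = (\<Sum>i\<in>UNIV. (cmod (gue_column S k g $ i))\<^sup>2)"
      by (simp add: norm_vec_def L2_set_def sum_nonneg)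
    also have "\<dots> = (\<Sum>i\<in>S. (cmod (gue_matrix g $ i $ k))\<^sup>2)"
      unfolding gue_column_def by (rule sum.mono_neutral_cong_right) auto
    also have "\<dots> = (\<Sum>i\<in>S. (\<Sum>b\<in>UNIV. (?X g (i, b))\<^sup>2)) / 2"
      unfolding sum_divide_distrib
      by (intro sum.cong) (auto simp: gue_matrix_nth cmod_power2 UNIV_bool power_divide field_simps)
    also have "\<dots> = (\<Sum>a\<in>S \<times> UNIV. (?X g a)\<^sup>2) / 2"
      unfolding sum.cartesian_product by (intro arg_cong2[where f="(/)"] sum.cong refl) auto
    also have "\<dots> = (sqrt (\<Sum>a\<in>S \<times> UNIV. (?X g a)\<^sup>2))\<^sup>2 / 2"
      by (subst real_sqrt_pow2) (auto intro: sum_nonneg)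
    finally show ?thesis .
  qed
  have "(\<integral>\<^sup>+g. F ((norm (gue_column S k g))\<^sup>2) \<partial>iid_normal) = (\<integral>\<^sup>+z. F (z\<^sup>2 / 2) \<partial>chi_measure (card (S \<times> (UNIV :: bool set))))"
    unfolding eq
    by (rule nn_integral_iid_normal_sum_squares[where F="\<lambda>z. F (z\<^sup>2 / 2)"])
      (use S in \<open>auto simp: inj_on_def split: if_splits\<close>)
  then show ?thesis by (simp add: card_cartesian_product mult.commute)
qed

section \<open>The law of two consecutive minors\<close>

lemma principal_measurable [measurable]: "principal S \<in> borel_measurable (borel :: (complex^'n^'n) measure)"
proof (intro borel_measurable_vec)
  fix i j
  show "(\<lambda>M :: complex^'n^'n. principal S M $ i $ j) \<in> borel_measurable borel"
    unfolding principal_nth by measurable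
qed

lemma border_measurable [measurable (raw)]:
  fixes A :: "'a \<Rightarrow> complex^'n^'n"
  assumes [measurable]: "A \<in> borel_measurable M" "v \<in> borel_measurable M"
  shows "(\<lambda>x. border k (A x) (v x) a) \<in> borel_measurable M"
proof (intro borel_measurable_vec)
  fix i j
  show "(\<lambda>x. border k (A x) (v x) a $ i $ j) \<in> borel_measurable M"
    unfolding border_def outer_def vector_add_component vec_lambda_beta by measurable
qed

lemma gue_column_measurable [measurable]: "gue_column S k \<in> borel_measurable iid_normal"
proof (intro borel_measurable_vec)
  fix i
  show "(\<lambda>g. gue_column S k g $ i) \<in> borel_measurable iid_normal"
    unfolding gue_column_def vec_lambda_beta by measurable
qed

definition gue_minor :: "'n::finite set \<Rightarrow> ('n \<times> 'n \<times> bool \<Rightarrow> real) \<Rightarrow> complex" where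
  "gue_minor S g = det (principal S (gue_matrix g))"

lemma gue_minor_measurable [measurable]: "gue_minor S \<in> borel_measurable iid_normal"
  unfolding gue_minor_def by measurable

lemma gue_minor_real: "gue_minor S g = of_real (Re (gue_minor S g))"
  unfolding gue_minor_def by (rule det_principal_real) simp

text \<open>Replacing \<open>d\<close> and \<open>e\<close> by their moduli changes the expression
  at most by an overall sign and by the sign of a, and a is symmetric.\<close>

lemma nn_integral_std_normal_abs_diff:
  assumes [measurable]: "F \<in> borel_measurable borel"
  shows "(\<integral>\<^sup>+a. F \<bar>a * d - r * e\<bar> \<partial>std_normal) = (\<integral>\<^sup>+a. F \<bar>a * \<bar>d\<bar> - r * \<bar>e\<bar>\<bar> \<partial>std_normal)"
proof -
  have "(\<forall>a. \<bar>a * d - r * e\<bar> = \<bar>a * \<bar>d\<bar> - r * \<bar>e\<bar>\<bar>) \<or> (\<forall>a. \<bar>a * d - r * e\<bar> = \<bar>- a * \<bar>d\<bar> - r * \<bar>e\<bar>\<bar>)"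
    by (cases "d \<ge> 0"; cases "e \<ge> 0") (auto simp: abs_if algebra_simps)
  then show ?thesis
    using nn_integral_std_normal_uminus[of "\<lambda>a. F \<bar>a * \<bar>d\<bar> - r * \<bar>e\<bar>\<bar>"] by auto
qed

text \<open>For a fixed new column \<open>v\<close>, unitary invariance of the old block allows \<open>v\<close> to be rotated
  onto a coordinate axis, so that only its length matters.\<close>

lemma gue_rotate_column:
  fixes S :: "'n::finite set"
  assumes [measurable]: "case_prod F \<in> borel_measurable (borel \<Otimes>\<^sub>M borel)"
    and j: "j \<in> S" and k: "k \<notin> S" and v: "\<And>i. i \<notin> S \<Longrightarrow> v $ i = 0"
  shows "(\<integral>\<^sup>+g. F (cmod (of_real a * gue_minor S g + det (border k (principal S (gue_matrix g)) v 0)))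
      (cmod (gue_minor S g)) \<partial>iid_normal) =
    (\<integral>\<^sup>+g. F (cmod (of_real a * gue_minor S g - of_real ((norm v)\<^sup>2) * gue_minor (S - {j}) g))
      (cmod (gue_minor S g)) \<partial>iid_normal)"
proof -
  obtain U c where U: "unitary U" "supported_on S U" and Uv: "U *v v = axis j c" and c: "cmod c = norm v"
    using unitary_to_axis[OF v j] by metis
  \<comment> \<open>\<open>V\<close> inverts \<open>U\<close> and carries \<open>axis j c\<close>
    back to \<open>v\<close>. Conjugating the matrix by \<open>V\<close> keeps the law and replaces
    the column \<open>v\<close> by \<open>axis j c\<close> inside the determinant.\<close>
  define V where "V = conj_transpose U"
  have V: "unitary V" "supported_on S V"
    using U by (auto simp: V_def unitary_def supported_on_conj_transpose)
  have v_eq: "v = V *v axis j c"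
  proof -
    have "V *v axis j c = (V ** U) *v v"
      unfolding Uv[symmetric] by (rule matrix_vector_mul_assoc)
    then show ?thesis using U by (simp add: V_def unitary_def)
  qed
  define f where "f M = F (cmod (of_real a * det (principal S M) + det (border k (principal S M) v 0)))
      (cmod (det (principal S M)))" for M
  have [measurable]: "f \<in> borel_measurable borel" unfolding f_def by measurable
  have fV: "f (V ** M ** conj_transpose V) =
    F (cmod (of_real a * det (principal S M) - of_real ((norm v)\<^sup>2) * det (principal (S - {j}) M))) (cmod (det (principal S M)))" for M
  proof -
    have "det (border k (principal S (V ** M ** conj_transpose V)) v 0) = - of_real ((norm v)\<^sup>2) * det (principal (S - {j}) M)"
      unfolding principal_conj[OF V(2)] by (subst v_eq)
        (simp only: border_conj[OF V(2) k] det_unitary_conj[OF V(1)] det_border_axis[OF k j] c)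
    moreover have "det (principal S (V ** M ** conj_transpose V)) = det (principal S M)"
      by (simp only: principal_conj[OF V(2)] det_unitary_conj[OF V(1)])
    ultimately show ?thesis by (simp add: f_def)
  qed
  show ?thesis
    using nn_integral_gue_unitary[of f V] V(1) unfolding fV unfolding f_def gue_minor_def by simp
qed

text \<open>The diagonal entry, the new column and the old block use disjoint coordinates. After
  decoupling, the column is rotated onto axis \<open>j\<close>, its squared length becomes z^2 / 2,
  and the symmetry of a absorbs the signs of the minors.\<close>

lemma gue_add_row:
  fixes S :: "'n::finite set"
  assumes F [measurable]: "case_prod F \<in> borel_measurable (borel \<Otimes>\<^sub>M borel)"
    and j: "j \<in> S" and k: "k \<notin> S"
  shows "(\<integral>\<^sup>+g. F (cmod (gue_minor (insert k S) g)) (cmod (gue_minor S g)) \<partial>iid_normal) =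
    (\<integral>\<^sup>+a. (\<integral>\<^sup>+z. (\<integral>\<^sup>+g. F \<bar>a * cmod (gue_minor S g) - z\<^sup>2 / 2 * cmod (gue_minor (S - {j}) g)\<bar>
      (cmod (gue_minor S g)) \<partial>iid_normal) \<partial>chi_measure (2 * card S)) \<partial>std_normal)"
proof -
  interpret I: prob_space "iid_normal :: ('n \<times> 'n \<times> bool \<Rightarrow> real) measure" by (rule prob_space_iid_normal)
  interpret N: prob_space std_normal by (rule prob_space_std_normal)
  interpret C: prob_space "chi_measure (2 * card S)" by (rule prob_space_chi_measure)
  interpret NI: pair_sigma_finite std_normal "iid_normal :: ('n \<times> 'n \<times> bool \<Rightarrow> real) measure" by standard
  interpret NC: pair_sigma_finite std_normal "chi_measure (2 * card S)" by standard
  \<comment> \<open>\<open>g\<close> supplies the old block, \<open>x\<close> the new row and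
    column.\<close>
  define H where "H g x = F (cmod (of_real (x (k, k, False)) * gue_minor S g +
      det (border k (principal S (gue_matrix g)) (gue_column S k x) 0))) (cmod (gue_minor S g))" for g x
  have [measurable]: "case_prod H \<in> borel_measurable (iid_normal \<Otimes>\<^sub>M iid_normal)"
    unfolding H_def by measurable
  define \<Phi> where "\<Phi> a r = (\<integral>\<^sup>+g. F (cmod (of_real a * gue_minor S g - of_real r * gue_minor (S - {j}) g))
      (cmod (gue_minor S g)) \<partial>iid_normal)" for a r
  have [measurable]: "case_prod \<Phi> \<in> borel_measurable (borel \<Otimes>\<^sub>M borel)"
    unfolding \<Phi>_def by measurable
  have "(\<integral>\<^sup>+g. F (cmod (gue_minor (insert k S) g)) (cmod (gue_minor S g)) \<partial>iid_normal) = (\<integral>\<^sup>+g. H g g \<partial>iid_normal)"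
  proof (rule nn_integral_cong)
    fix g :: "'n \<times> 'n \<times> bool \<Rightarrow> real"
    have v: "gue_column S k g $ k = 0" using k by (simp add: gue_column_def)
    have "principal (insert k S) (gue_matrix g) =
      border k (principal S (gue_matrix g)) (gue_column S k g) (of_real (g (k, k, False)))"
      using principal_insert[OF conj_transpose_gue_matrix k, of g] unfolding gue_column_def gue_matrix_diag .
    then have "gue_minor (insert k S) g = of_real (g (k, k, False)) * gue_minor S g +
      det (border k (principal S (gue_matrix g)) (gue_column S k g) 0)"
      unfolding gue_minor_def using det_border[OF k v] by (rule subst[OF sym])
    then show "F (cmod (gue_minor (insert k S) g)) (cmod (gue_minor S g)) = H g g"
      by (simp add: H_def)
  qed
  also have "\<dots> = (\<integral>\<^sup>+x. (\<integral>\<^sup>+g. H g x \<partial>iid_normal) \<partial>iid_normal)"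
  proof (rule nn_integral_iid_normal_decouple[where I="S \<times> S \<times> UNIV"])
    fix g g' x y :: "'n \<times> 'n \<times> bool \<Rightarrow> real"
    assume g: "\<And>p. p \<in> S \<times> S \<times> UNIV \<Longrightarrow> g p = g' p" and x: "\<And>p. p \<notin> S \<times> S \<times> UNIV \<Longrightarrow> x p = y p"
    have "principal S (gue_matrix g) = principal S (gue_matrix g')"
      using g by (simp add: vec_eq_iff principal_nth gue_matrix_nth)
    moreover have "gue_column S k x = gue_column S k y"
      using x k by (simp add: vec_eq_iff gue_column_def gue_matrix_nth)
    ultimately show "H g x = H g' y"
      using x k by (simp add: H_def gue_minor_def)
  qed measurable
  also have "\<dots> = (\<integral>\<^sup>+x. \<Phi> (x (k, k, False)) ((norm (gue_column S k x))\<^sup>2) \<partial>iid_normal)"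
    unfolding H_def \<Phi>_def
    by (intro nn_integral_cong gue_rotate_column[OF F j k]) (simp add: gue_column_def)
  \<comment> \<open>A second decoupling separates the diagonal entry from the length of the
    column.\<close>
  also have "\<dots> = (\<integral>\<^sup>+x. (\<integral>\<^sup>+g. \<Phi> (g (k, k, False)) ((norm (gue_column S k x))\<^sup>2) \<partial>iid_normal) \<partial>iid_normal)"
  proof (rule nn_integral_iid_normal_decouple[where I="{(k, k, False)}" and
        H="\<lambda>g x. \<Phi> (g (k, k, False)) ((norm (gue_column S k x))\<^sup>2)"])
    fix g g' x y :: "'n \<times> 'n \<times> bool \<Rightarrow> real"
    assume g: "\<And>p. p \<in> {(k, k, False)} \<Longrightarrow> g p = g' p" and x: "\<And>p. p \<notin> {(k, k, False)} \<Longrightarrow> x p = y p"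
    have "x (i, k, b) = y (i, k, b)" "x (k, i, b) = y (k, i, b)" if "i \<in> S" for i b
      using that k by (auto intro!: x)
    then have "gue_column S k x = gue_column S k y"
      by (simp add: vec_eq_iff gue_column_def gue_matrix_nth)
    then show "\<Phi> (g (k, k, False)) ((norm (gue_column S k x))\<^sup>2) = \<Phi> (g' (k, k, False)) ((norm (gue_column S k y))\<^sup>2)"
      using g by simp
  qed measurable
  also have "\<dots> = (\<integral>\<^sup>+x. (\<integral>\<^sup>+a. \<Phi> a ((norm (gue_column S k x))\<^sup>2) \<partial>std_normal) \<partial>iid_normal)"
    by (intro nn_integral_cong nn_integral_iid_normal_component[where F="\<lambda>a. \<Phi> a _"]) measurable
  also have "\<dots> = (\<integral>\<^sup>+z. (\<integral>\<^sup>+a. \<Phi> a (z\<^sup>2 / 2) \<partial>std_normal) \<partial>chi_measure (2 * card S))"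
    using j k by (intro nn_integral_gue_column[where F="\<lambda>r. \<integral>\<^sup>+a. \<Phi> a r \<partial>std_normal"]) auto
  also have "\<dots> = (\<integral>\<^sup>+z. (\<integral>\<^sup>+a. (\<integral>\<^sup>+g. F \<bar>a * cmod (gue_minor S g) - z\<^sup>2 / 2 * cmod (gue_minor (S - {j}) g)\<bar>
      (cmod (gue_minor S g)) \<partial>iid_normal) \<partial>std_normal) \<partial>chi_measure (2 * card S))"
  proof (rule nn_integral_cong)
    fix z :: real
    have "(\<integral>\<^sup>+a. \<Phi> a (z\<^sup>2 / 2) \<partial>std_normal) = (\<integral>\<^sup>+g. (\<integral>\<^sup>+a. F (cmod (of_real a * gue_minor S g - of_real (z\<^sup>2 / 2) * gue_minor (S - {j}) g))
      (cmod (gue_minor S g)) \<partial>std_normal) \<partial>iid_normal)"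
      unfolding \<Phi>_def by (rule NI.Fubini'[symmetric]) measurable
    also have "\<dots> = (\<integral>\<^sup>+g. (\<integral>\<^sup>+a. F \<bar>a * cmod (gue_minor S g) - z\<^sup>2 / 2 * cmod (gue_minor (S - {j}) g)\<bar>
      (cmod (gue_minor S g)) \<partial>std_normal) \<partial>iid_normal)"
    proof (rule nn_integral_cong)
      fix g :: "'n \<times> 'n \<times> bool \<Rightarrow> real"
      \<comment> \<open>Minors of a hermitian matrix are real, so complex moduli reduce to absolute
        values.\<close>
      obtain d e where de: "gue_minor S g = of_real d" "gue_minor (S - {j}) g = of_real e"
        using gue_minor_real by metis
      have "cmod (of_real a * of_real d - of_real (z\<^sup>2 / 2) * of_real e) = \<bar>a * d - z\<^sup>2 / 2 * e\<bar>" for a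
        by (simp only: of_real_mult[symmetric] of_real_diff[symmetric] norm_of_real)
      then show "(\<integral>\<^sup>+a. F (cmod (of_real a * gue_minor S g - of_real (z\<^sup>2 / 2) * gue_minor (S - {j}) g))
          (cmod (gue_minor S g)) \<partial>std_normal) =
        (\<integral>\<^sup>+a. F \<bar>a * cmod (gue_minor S g) - z\<^sup>2 / 2 * cmod (gue_minor (S - {j}) g)\<bar> (cmod (gue_minor S g)) \<partial>std_normal)"
        using nn_integral_std_normal_abs_diff[of "\<lambda>s. F s \<bar>d\<bar>" d "z\<^sup>2 / 2" e]
        unfolding de by (simp only: norm_of_real) simp
    qed
    also have "\<dots> = (\<integral>\<^sup>+a. (\<integral>\<^sup>+g. F \<bar>a * cmod (gue_minor S g) - z\<^sup>2 / 2 * cmod (gue_minor (S - {j}) g)\<bar>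
      (cmod (gue_minor S g)) \<partial>iid_normal) \<partial>std_normal)"
      by (rule NI.Fubini') measurable
    finally show "(\<integral>\<^sup>+a. \<Phi> a (z\<^sup>2 / 2) \<partial>std_normal) = \<dots>" .
  qed
  also have "\<dots> = (\<integral>\<^sup>+a. (\<integral>\<^sup>+z. (\<integral>\<^sup>+g. F \<bar>a * cmod (gue_minor S g) - z\<^sup>2 / 2 * cmod (gue_minor (S - {j}) g)\<bar>
      (cmod (gue_minor S g)) \<partial>iid_normal) \<partial>chi_measure (2 * card S)) \<partial>std_normal)"
    by (rule NC.Fubini') measurable
  finally show ?thesis .
qed

section \<open>Products of chi factors and the induction over minors\<close>

text \<open>The law of \<open>X\<^sub>2 \<cdots> X\<^sub>m\<^sub>+\<^sub>1\<close> in the notation of the theorem.\<close>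

primrec chi_product_law :: "nat \<Rightarrow> real measure" where
  "chi_product_law 0 = return borel 1"
| "chi_product_law (Suc m) =
    distr (chi_measure (2 * (Suc (Suc m) div 2) + 1) \<Otimes>\<^sub>M chi_product_law m) borel (\<lambda>(z, y). z * y)"

lemma sets_chi_product_law [simp, measurable_cong]: "sets (chi_product_law m) = sets borel"
  by (cases m) auto

lemma prob_space_chi_product_law: "prob_space (chi_product_law m)"
proof (induction m)
  case (Suc m)
  interpret Y: prob_space "chi_product_law m" by (rule Suc)
  interpret Z: prob_space "chi_measure k" for k by (rule prob_space_chi_measure)
  interpret pair_prob_space "chi_measure (2 * (Suc (Suc m) div 2) + 1)" "chi_product_law m" ..
  show ?case
    unfolding chi_product_law.simps by (rule prob_space_distr) measurable
qed (simp add: prob_space_return)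

lemma nn_integral_chi_product_law_Suc:
  assumes [measurable]: "F \<in> borel_measurable borel"
  shows "(\<integral>\<^sup>+y. F y \<partial>chi_product_law (Suc m)) =
    (\<integral>\<^sup>+z. (\<integral>\<^sup>+y. F (z * y) \<partial>chi_product_law m) \<partial>chi_measure (2 * (Suc (Suc m) div 2) + 1))"
proof -
  interpret Y: prob_space "chi_product_law m" by (rule prob_space_chi_product_law)
  have "(\<integral>\<^sup>+y. F y \<partial>chi_product_law (Suc m)) =
    (\<integral>\<^sup>+p. F (fst p * snd p) \<partial>(chi_measure (2 * (Suc (Suc m) div 2) + 1) \<Otimes>\<^sub>M chi_product_law m))"
    unfolding chi_product_law.simps by (subst nn_integral_distr) (auto simp: case_prod_unfold)
  also have "\<dots> = (\<integral>\<^sup>+z. (\<integral>\<^sup>+y. F (z * y) \<partial>chi_product_law m) \<partial>chi_measure (2 * (Suc (Suc m) div 2) + 1))"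
    by (subst Y.nn_integral_fst[symmetric]) auto
  finally show ?thesis .
qed

text \<open>Positivity lets the common factor leave the absolute value in the proof of
  \<open>gue_minors_law\<close>.\<close>

lemma AE_chi_product_law_pos: "AE y in chi_product_law m. y > 0"
proof (induction m)
  case (Suc m)
  interpret Y: prob_space "chi_product_law m" by (rule prob_space_chi_product_law)
  interpret Z: prob_space "chi_measure k" for k by (rule prob_space_chi_measure)
  interpret pair_sigma_finite "chi_measure (2 * (Suc (Suc m) div 2) + 1)" "chi_product_law m" ..
  have "AE p in chi_measure (2 * (Suc (Suc m) div 2) + 1) \<Otimes>\<^sub>M chi_product_law m. 0 < fst p * snd p"
  proof (rule AE_pair_measure)
    show "AE z in chi_measure (2 * (Suc (Suc m) div 2) + 1). AE y in chi_product_law m. 0 < fst (z, y) * snd (z, y)"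
      using AE_chi_measure_pos
    proof eventually_elim
      case (elim z)
      show ?case using Suc by eventually_elim (use elim in simp)
    qed
  qed measurable
  then show ?case
    unfolding chi_product_law.simps by (subst AE_distr_iff) (auto simp: case_prod_unfold)
next
  case 0
  show ?case unfolding chi_product_law.simps by (subst AE_return) auto
qed

text \<open>The witness \<open>j\<close> is the index added last: after inserting \<open>k\<close>
  the new witness is \<open>k\<close>, and removing it returns the previous set. Quantifying over
  all \<open>F\<close> lets the induction hypothesis be applied to combinations of both
  minors.\<close>

theorem gue_minors_law:
  fixes S :: "'n::finite set"
  assumes "S \<noteq> {}"
  shows "\<exists>j\<in>S. \<forall>F. case_prod F \<in> borel_measurable (borel \<Otimes>\<^sub>M borel) \<longrightarrow>
    (\<integral>\<^sup>+g. F (cmod (gue_minor S g)) (cmod (gue_minor (S - {j}) g)) \<partial>iid_normal) =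
    (\<integral>\<^sup>+x. (\<integral>\<^sup>+v. (\<integral>\<^sup>+y. F (x * y) (v * y) \<partial>chi_product_law (card S - 1)) \<partial>ratio_measure (card S)) \<partial>chi_measure 1)"
  using finite assms
proof (induction S rule: finite_ne_induct)
  case (singleton j)
  \<comment> \<open>The empty minor is 1 by the identity padding, which matches the point mass
    \<open>ratio_measure 1\<close>.\<close>
  have minor: "gue_minor {j} g = of_real (g (j, j, False))" "gue_minor {} g = 1" for g
  proof -
    show "gue_minor {} g = 1" by (simp add: gue_minor_def)
    show "gue_minor {j} g = of_real (g (j, j, False))"
      unfolding gue_minor_def
      by (subst det_diagonal) (auto simp: principal_nth gue_matrix_diag prod.If_cases if_distrib[of _ True])
  qed
  have "(\<integral>\<^sup>+g. F \<bar>g (j, j, False)\<bar> 1 \<partial>iid_normal) = (\<integral>\<^sup>+x. F x 1 \<partial>chi_measure 1)"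
    if [measurable]: "case_prod F \<in> borel_measurable (borel \<Otimes>\<^sub>M borel)" for F
    using nn_integral_iid_normal_component[of "\<lambda>x. F \<bar>x\<bar> 1"] nn_integral_std_normal_abs[of "\<lambda>x. F x 1"] by simp
  then show ?case
    by (auto simp: minor ratio_measure_def nn_integral_return)
next
  case (insert k S)
  let ?n = "card S"
  define m where "m = ?n - 1"
  have n: "?n = Suc m" using insert by (simp add: m_def card_gt_0_iff)
  obtain j where j: "j \<in> S" and IH: "\<And>F. case_prod F \<in> borel_measurable (borel \<Otimes>\<^sub>M borel) \<Longrightarrow>
    (\<integral>\<^sup>+g. F (cmod (gue_minor S g)) (cmod (gue_minor (S - {j}) g)) \<partial>iid_normal) =
    (\<integral>\<^sup>+x. (\<integral>\<^sup>+v. (\<integral>\<^sup>+y. F (x * y) (v * y) \<partial>chi_product_law m) \<partial>ratio_measure ?n) \<partial>chi_measure 1)"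
    using insert.IH unfolding m_def by blast
  interpret Y: prob_space "chi_product_law l" for l by (rule prob_space_chi_product_law)
  interpret V: prob_space "ratio_measure l" for l by (rule prob_space_ratio_measure)
  interpret C: prob_space "chi_measure l" for l by (rule prob_space_chi_measure)
  interpret CC: pair_sigma_finite "chi_measure l" "chi_measure l'" for l l' by standard
  interpret CV: pair_sigma_finite "chi_measure l" "ratio_measure l'" for l l' by standard
  let ?\<chi> = "chi_measure (2 * (Suc ?n div 2) + 1)"
  have "(\<integral>\<^sup>+g. F (cmod (gue_minor (insert k S) g)) (cmod (gue_minor S g)) \<partial>iid_normal) =
    (\<integral>\<^sup>+x. (\<integral>\<^sup>+v. (\<integral>\<^sup>+y. F (x * y) (v * y) \<partial>chi_product_law ?n) \<partial>ratio_measure (Suc ?n)) \<partial>chi_measure 1)"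
    if F [measurable]: "case_prod F \<in> borel_measurable (borel \<Otimes>\<^sub>M borel)" for F
  proof -
    \<comment> \<open>\<open>G\<close> hides the common factor y, so that
      \<open>minor_recursion\<close> applies to the remaining pair.\<close>
    define G where "G p q = (\<integral>\<^sup>+y. F (p * y) (q * y) \<partial>chi_product_law m)" for p q
    have G [measurable]: "case_prod G \<in> borel_measurable (borel \<Otimes>\<^sub>M borel)"
      unfolding G_def by measurable
    have "(\<integral>\<^sup>+g. F \<bar>a * cmod (gue_minor S g) - z\<^sup>2 / 2 * cmod (gue_minor (S - {j}) g)\<bar> (cmod (gue_minor S g)) \<partial>iid_normal) =
      (\<integral>\<^sup>+x. (\<integral>\<^sup>+v. G \<bar>a * x - z\<^sup>2 / 2 * v\<bar> x \<partial>ratio_measure ?n) \<partial>chi_measure 1)" for a z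
    proof -
      have "(\<integral>\<^sup>+g. F \<bar>a * cmod (gue_minor S g) - z\<^sup>2 / 2 * cmod (gue_minor (S - {j}) g)\<bar> (cmod (gue_minor S g)) \<partial>iid_normal) =
        (\<integral>\<^sup>+x. (\<integral>\<^sup>+v. (\<integral>\<^sup>+y. F \<bar>a * (x * y) - z\<^sup>2 / 2 * (v * y)\<bar> (x * y) \<partial>chi_product_law m) \<partial>ratio_measure ?n) \<partial>chi_measure 1)"
        by (rule IH[of "\<lambda>p q. F \<bar>a * p - z\<^sup>2 / 2 * q\<bar> p"]) measurable
      also have "\<dots> = (\<integral>\<^sup>+x. (\<integral>\<^sup>+v. G \<bar>a * x - z\<^sup>2 / 2 * v\<bar> x \<partial>ratio_measure ?n) \<partial>chi_measure 1)"
        unfolding G_def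
      proof (rule nn_integral_cong, rule nn_integral_cong, rule nn_integral_cong_AE)
        fix x v :: real
        show "AE y in chi_product_law m. F \<bar>a * (x * y) - z\<^sup>2 / 2 * (v * y)\<bar> (x * y) = F (\<bar>a * x - z\<^sup>2 / 2 * v\<bar> * y) (x * y)"
          using AE_chi_product_law_pos
        proof eventually_elim
          case (elim y)
          \<comment> \<open>Both terms are linear in \<open>y\<close>, and \<open>y > 0\<close>
            almost surely, so \<open>y\<close> leaves the modulus.\<close>
          have "a * (x * y) - z\<^sup>2 / 2 * (v * y) = (a * x - z\<^sup>2 / 2 * v) * y" by (simp add: algebra_simps)
          then show ?case using elim by (simp only: abs_mult abs_of_pos)
        qed
      qed
      finally show ?thesis .
    qed
    then have "(\<integral>\<^sup>+g. F (cmod (gue_minor (insert k S) g)) (cmod (gue_minor S g)) \<partial>iid_normal) =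
      (\<integral>\<^sup>+a. (\<integral>\<^sup>+z. (\<integral>\<^sup>+x. (\<integral>\<^sup>+v. G \<bar>a * x - z\<^sup>2 / 2 * v\<bar> x \<partial>ratio_measure ?n) \<partial>chi_measure 1) \<partial>chi_measure (2 * ?n)) \<partial>std_normal)"
      using gue_add_row[OF F j \<open>k \<notin> S\<close>] by simp
    also have "\<dots> = (\<integral>\<^sup>+z. (\<integral>\<^sup>+x. (\<integral>\<^sup>+v. G (x * z) (v * z) \<partial>ratio_measure (Suc ?n)) \<partial>chi_measure 1) \<partial>?\<chi>)"
      by (rule minor_recursion[OF G]) (simp add: n)
    \<comment> \<open>The new chi factor \<open>z\<close> is moved inward next to the old product,
      with which it forms the product law with one more factor.\<close>
    also have "\<dots> = (\<integral>\<^sup>+x. (\<integral>\<^sup>+z. (\<integral>\<^sup>+v. G (x * z) (v * z) \<partial>ratio_measure (Suc ?n)) \<partial>?\<chi>) \<partial>chi_measure 1)"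
      by (rule CC.Fubini') measurable
    also have "\<dots> = (\<integral>\<^sup>+x. (\<integral>\<^sup>+v. (\<integral>\<^sup>+z. G (x * z) (v * z) \<partial>?\<chi>) \<partial>ratio_measure (Suc ?n)) \<partial>chi_measure 1)"
      by (intro nn_integral_cong CV.Fubini'[symmetric]) measurable
    also have "\<dots> = (\<integral>\<^sup>+x. (\<integral>\<^sup>+v. (\<integral>\<^sup>+y. F (x * y) (v * y) \<partial>chi_product_law ?n) \<partial>ratio_measure (Suc ?n)) \<partial>chi_measure 1)"
    proof (intro nn_integral_cong)
      fix x v :: real
      show "(\<integral>\<^sup>+z. G (x * z) (v * z) \<partial>?\<chi>) = (\<integral>\<^sup>+y. F (x * y) (v * y) \<partial>chi_product_law ?n)"
        using nn_integral_chi_product_law_Suc[of "\<lambda>y. F (x * y) (v * y)" m]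
        by (simp add: G_def n mult.assoc del: chi_product_law.simps)
    qed
    finally show ?thesis .
  qed
  moreover have "insert k S - {k} = S" using insert by auto
  ultimately show ?case using insert by (intro bexI[of _ k]) auto
qed

section \<open>Transfer to given random variables\<close>

lemma (in prob_space) nn_integral_indep_mult:
  assumes ind: "indep_var borel X borel Y" and [measurable]: "F \<in> borel_measurable borel"
  shows "(\<integral>\<^sup>+\<omega>. F (X \<omega> * Y \<omega>) \<partial>M) = (\<integral>\<^sup>+x. (\<integral>\<^sup>+y. F (x * y :: real) \<partial>distr M borel Y) \<partial>distr M borel X)"
proof -
  have [measurable]: "X \<in> borel_measurable M" "Y \<in> borel_measurable M"
    using ind by (auto dest: indep_var_rv1 indep_var_rv2)
  interpret Y: prob_space "distr M borel Y" by (rule prob_space_distr) simp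
  have "(\<integral>\<^sup>+x. (\<integral>\<^sup>+y. F (x * y) \<partial>distr M borel Y) \<partial>distr M borel X) =
    (\<integral>\<^sup>+p. F (fst p * snd p) \<partial>(distr M borel X \<Otimes>\<^sub>M distr M borel Y))"
    by (subst Y.nn_integral_fst[symmetric]) auto
  also have "\<dots> = (\<integral>\<^sup>+p. F (fst p * snd p) \<partial>distr M (borel \<Otimes>\<^sub>M borel) (\<lambda>\<omega>. (X \<omega>, Y \<omega>)))"
    using ind by (simp add: indep_var_distribution_eq)
  also have "\<dots> = (\<integral>\<^sup>+\<omega>. F (X \<omega> * Y \<omega>) \<partial>M)"
    by (subst nn_integral_distr) auto
  finally show ?thesis ..
qed

lemma emeasure_distr_eq_nn_integral:
  assumes "f \<in> M \<rightarrow>\<^sub>M N" "A \<in> sets N"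
  shows "emeasure (distr M N f) A = (\<integral>\<^sup>+x. indicator A (f x) \<partial>M)"
  using assms nn_integral_distr[of f M N "indicator A"] by simp

text \<open>The product starts at index 2 because \<open>gue_minors_law\<close> keeps the first chi
  variable separate. Each step splits off the last factor, which is independent of the preceding
  product.\<close>

lemma (in prob_space) distr_prod_chi:
  assumes indep: "indep_vars (\<lambda>_. borel) X {1..n}"
    and law: "\<And>i. i \<in> {1..n} \<Longrightarrow> distr M borel (X i) = chi_measure (2 * (i div 2) + 1)"
    and m: "Suc m \<le> n"
  shows "distr M borel (\<lambda>\<omega>. \<Prod>i=2..Suc m. X i \<omega>) = chi_product_law m"
  using m
proof (induction m)
  case 0
  show ?case by (simp add: distr_const)
next
  case (Suc m)
  have [measurable]: "X i \<in> borel_measurable M" if "i \<in> {1..n}" for i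
    using indep that by (auto simp: indep_vars_def)
  have [measurable]: "(\<lambda>\<omega>. \<Prod>i=2..l. X i \<omega>) \<in> borel_measurable M" if "l \<le> n" for l
    using that by (intro borel_measurable_prod) auto
  have I: "{2..Suc (Suc m)} = insert (Suc (Suc m)) {2..Suc m}" by auto
  have ind: "indep_var borel (X (Suc (Suc m))) borel (\<lambda>\<omega>. \<Prod>i=2..Suc m. X i \<omega>)"
    by (rule indep_vars_prod) (use Suc.prems in \<open>auto intro!: indep_vars_subset[OF indep]\<close>)
  show ?case
  proof (rule measure_eqI)
    fix A assume "A \<in> sets (distr M borel (\<lambda>\<omega>. \<Prod>i=2..Suc (Suc m). X i \<omega>))"
    then have [measurable]: "A \<in> sets borel" by simp
    have "emeasure (distr M borel (\<lambda>\<omega>. \<Prod>i=2..Suc (Suc m). X i \<omega>)) A =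
      (\<integral>\<^sup>+\<omega>. indicator A (\<Prod>i=2..Suc (Suc m). X i \<omega>) \<partial>M)"
      using Suc.prems by (intro emeasure_distr_eq_nn_integral) auto
    also have "\<dots> = (\<integral>\<^sup>+\<omega>. indicator A (X (Suc (Suc m)) \<omega> * (\<Prod>i=2..Suc m. X i \<omega>)) \<partial>M)"
      unfolding I by (subst prod.insert) auto
    also have "\<dots> = (\<integral>\<^sup>+x. (\<integral>\<^sup>+y. indicator A (x * y) \<partial>chi_product_law m) \<partial>chi_measure (2 * (Suc (Suc m) div 2) + 1))"
      using Suc nn_integral_indep_mult[OF ind, of "indicator A"] law[of "Suc (Suc m)"] by simp
    also have "\<dots> = emeasure (chi_product_law (Suc m)) A"
      using nn_integral_chi_product_law_Suc[of "indicator A" m] by (simp del: chi_product_law.simps)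
    finally show "emeasure (distr M borel (\<lambda>\<omega>. \<Prod>i=2..Suc (Suc m). X i \<omega>)) A = emeasure (chi_product_law (Suc m)) A" .
  qed (simp del: chi_product_law.simps)
qed

theorem theorem2:
  fixes P :: "'a measure" and M :: "'a \<Rightarrow> complex^'n^'n"
    and Q :: "'b measure" and X :: "nat \<Rightarrow> 'b \<Rightarrow> real"
  assumes "prob_space P"
    and "M \<in> measurable P borel"
    and "distr P borel M = gue"
    and "prob_space Q"
    and "prob_space.indep_vars Q (\<lambda>_. borel) X {1..CARD('n)}"
    and "\<And>i. i \<in> {1..CARD('n)} \<Longrightarrow>
           distributed Q lborel (X i) (\<lambda>x. ennreal (chi_density (2 * (i div 2) + 1) x))"
  shows "distr P borel (\<lambda>\<omega>. cmod (det (M \<omega>))) =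
         distr Q borel (\<lambda>\<omega>. \<Prod>i = 1..CARD('n). X i \<omega>)"
proof (rule measure_eqI)
  interpret Q: prob_space Q by fact
  note [measurable] = assms(2)
  let ?n = "CARD('n)"
  have n: "1 \<le> ?n" by (simp add: Suc_le_eq)
  have law: "distr Q borel (X i) = chi_measure (2 * (i div 2) + 1)" if "i \<in> {1..?n}" for i
  proof -
    have "distr Q borel (X i) = distr Q lborel (X i)" by (rule distr_cong) auto
    then show ?thesis
      using distributed_distr_eq_density[OF assms(6)[OF that]] by (simp add: chi_measure_def)
  qed
  have [measurable]: "X i \<in> borel_measurable Q" if "i \<in> {1..?n}" for i
    using assms(5) that by (auto simp: Q.indep_vars_def)
  have prod_meas: "(\<lambda>\<omega>. \<Prod>i=1..?n. X i \<omega>) \<in> borel_measurable Q"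
    by (intro borel_measurable_prod) auto
  \<comment> \<open>The factor with index 1 has 2 (1 div 2) + 1 = 1 degree of freedom and plays the
    part of the separate chi variable.\<close>
  have I: "{1..?n} = insert 1 {2..?n}" using n by auto
  have ind: "Q.indep_var borel (X 1) borel (\<lambda>\<omega>. \<Prod>i=2..?n. X i \<omega>)"
    using assms(5) unfolding I by (intro Q.indep_vars_prod) auto
  interpret V: prob_space "ratio_measure l" for l by (rule prob_space_ratio_measure)
  fix A assume "A \<in> sets (distr P borel (\<lambda>\<omega>. cmod (det (M \<omega>))))"
  then have [measurable]: "A \<in> sets borel" by simp
  have "emeasure (distr P borel (\<lambda>\<omega>. cmod (det (M \<omega>)))) A = (\<integral>\<^sup>+\<omega>. indicator A (cmod (det (M \<omega>))) \<partial>P)"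
    by (intro emeasure_distr_eq_nn_integral) auto
  also have "\<dots> = (\<integral>\<^sup>+W. indicator A (cmod (det W)) \<partial>distr P borel M)"
    by (subst nn_integral_distr) auto
  also have "\<dots> = (\<integral>\<^sup>+g. indicator A (cmod (gue_minor (UNIV :: 'n set) g)) \<partial>iid_normal)"
    unfolding assms(3) gue_eq by (subst nn_integral_distr) (auto simp: gue_minor_def)
  also have "\<dots> = (\<integral>\<^sup>+x. (\<integral>\<^sup>+y. indicator A (x * y) \<partial>chi_product_law (?n - 1)) \<partial>chi_measure 1)"
  proof -
    obtain j :: 'n where "\<forall>F. case_prod F \<in> borel_measurable (borel \<Otimes>\<^sub>M borel) \<longrightarrow>
      (\<integral>\<^sup>+g. F (cmod (gue_minor UNIV g)) (cmod (gue_minor (UNIV - {j}) g)) \<partial>iid_normal) =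
      (\<integral>\<^sup>+x. (\<integral>\<^sup>+v. (\<integral>\<^sup>+y. F (x * y) (v * y) \<partial>chi_product_law (?n - 1)) \<partial>ratio_measure ?n) \<partial>chi_measure 1)"
      using gue_minors_law[of "UNIV :: 'n set"] by auto
    \<comment> \<open>The test function ignores the second minor, so the ratio law integrates to
      1.\<close>
    from this[rule_format, of "\<lambda>x _. indicator A x"] show ?thesis
      by (simp add: V.emeasure_space_1)
  qed
  also have "\<dots> = (\<integral>\<^sup>+\<omega>. indicator A (X 1 \<omega> * (\<Prod>i=2..?n. X i \<omega>)) \<partial>Q)"
    using Q.nn_integral_indep_mult[OF ind, of "indicator A"] law[of 1] n
      Q.distr_prod_chi[OF assms(5) law, of "?n - 1"] by simp
  also have "\<dots> = (\<integral>\<^sup>+\<omega>. indicator A (\<Prod>i=1..?n. X i \<omega>) \<partial>Q)"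
    unfolding I by (subst prod.insert) auto
  also have "\<dots> = emeasure (distr Q borel (\<lambda>\<omega>. \<Prod>i=1..?n. X i \<omega>)) A"
    using prod_meas by (intro emeasure_distr_eq_nn_integral[symmetric]) auto
  finally show "emeasure (distr P borel (\<lambda>\<omega>. cmod (det (M \<omega>)))) A =
    emeasure (distr Q borel (\<lambda>\<omega>. \<Prod>i=1..?n. X i \<omega>)) A" .
qed simp

end
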